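(* There exists an instance $(T,\rho,n,S)$ of NICD on trees for which there is no simple optimal protocol. In fact, given any $\rho\in(0,1)$ and any $n\ge4$, there are integers $k_1$ and $k_2$ such that if $T$ is a $k_1$-leaf star together with a path of length $k_2$ coming out of the center of the star (so $T$ has $k_1+k_2+1$ vertices: a center, $k_1$ leaves adjacent to it, and a path with $k_2$ edges starting at the center) and $S=V(T)$ is the full vertex set of $T$, then the instance $(T,\rho,n,S)$ has no simple optimal protocol.
   Context: NICD on trees. An instance consists of a finite undirected tree $T$, a correlation parameter $\rho\in(0,1)$, an integer $n\ge1$ and a set of players $S\subseteq V(T)$. Random strings $x^{(v)}\in\{-1,1\}^n$, $v\in V(T)$, are generated as follows: the $n$ coordinates are independent, and for each coordinate $i$ the vector $\alpha=(x^{(v)}_i)_{v\in V(T)}\in\{-1,1\}^{V(T)}$ has probability $\mathbf{P}(\alpha)=\frac12(\frac12+\frac12\rho)^{A(\alpha)}(\frac12-\frac12\rho)^{B(\alpha)}$, where $A(\alpha)$, $B(\alpha)$ are the numbers of edges of $T$ whose endpoints agree, respectively disagree, in $\alpha$. A function $f:\{-1,1\}^n\to\{-1,1\}$ is balanced if it takes each value on exactly $2^{n-1}$ inputs. A protocol is a family $(f_v)_{v\in S}$ of balanced functions; it is simple if all $f_v$ are the same function. $\mathcal{P}(T,\rho,n,S,(f_v)_{v\in S})$ is the probability that all the bits $f_v(x^{(v)})$, $v\in S$, are equal. Define $\mathcal{M}(T,\rho,n,S)=\sup_{(f_v)}\mathcal{P}(T,\rho,n,S,(f_v))$ over all protocols.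 A protocol is optimal for $(T,\rho,n,S)$ if it attains $\mathcal{M}(T,\rho,n,S)$. *)

theory Defs
  imports "HOL-Probability.Probability"
begin

section \<open>Finite undirected trees\<close>

text \<open>
  Edges are two-element sets of vertices, so that the edges on whose endpoints a labelling agrees
  or disagrees can be counted directly.
\<close>

record 'v ugraph =
  verts :: "'v set"
  edges :: "'v set set"

definition adjacency :: "'v ugraph \<Rightarrow> ('v \<times> 'v) set" where
  "adjacency T = {(u, v). {u, v} \<in> edges T}"

definition finite_simple_graph :: "'v ugraph \<Rightarrow> bool" where
  "finite_simple_graph T \<longleftrightarrow> finite (verts T) \<and> (\<forall>e\<in>edges T. e \<subseteq> verts T \<and> card e = 2)"

definition connected_graph :: "'v ugraph \<Rightarrow> bool" where
  "connected_graph T \<longleftrightarrow>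
     verts T \<noteq> {} \<and> (\<forall>u\<in>verts T. \<forall>v\<in>verts T. (u, v) \<in> (adjacency T)\<^sup>*)"

text \<open>A cycle is given by the list of its vertices; the last one is adjacent to the first.\<close>

definition graph_cycle :: "'v ugraph \<Rightarrow> 'v list \<Rightarrow> bool" where
  "graph_cycle T p \<longleftrightarrow> 3 \<le> length p \<and> distinct p \<and>
     (\<forall>i<length p. {p ! i, p ! (Suc i mod length p)} \<in> edges T)"

definition finite_tree :: "'v ugraph \<Rightarrow> bool" where
  "finite_tree T \<longleftrightarrow> finite_simple_graph T \<and> connected_graph T \<and> (\<nexists>p. graph_cycle T p)"

definition nicd_instance :: "'v ugraph \<Rightarrow> real \<Rightarrow> nat \<Rightarrow> 'v set \<Rightarrow> bool" where
  "nicd_instance T \<rho> n S \<longleftrightarrow>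
     finite_tree T \<and> 0 < \<rho> \<and> \<rho> < 1 \<and> 1 \<le> n \<and> S \<subseteq> verts T"


section \<open>The distribution of the strings\<close>

definition agreeing_edges :: "'v ugraph \<Rightarrow> ('v \<Rightarrow> int) \<Rightarrow> 'v set set" where
  "agreeing_edges T \<alpha> = {e \<in> edges T. \<forall>u\<in>e. \<forall>v\<in>e. \<alpha> u = \<alpha> v}"

definition disagreeing_edges :: "'v ugraph \<Rightarrow> ('v \<Rightarrow> int) \<Rightarrow> 'v set set" where
  "disagreeing_edges T \<alpha> = {e \<in> edges T. \<exists>u\<in>e. \<exists>v\<in>e. \<alpha> u \<noteq> \<alpha> v}"

definition label_prob :: "'v ugraph \<Rightarrow> real \<Rightarrow> ('v \<Rightarrow> int) \<Rightarrow> real" where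
  "label_prob T \<rho> \<alpha> =
     1/2 * (1/2 + 1/2 * \<rho>) ^ card (agreeing_edges T \<alpha>)
         * (1/2 - 1/2 * \<rho>) ^ card (disagreeing_edges T \<alpha>)"

definition label_measure :: "'v ugraph \<Rightarrow> real \<Rightarrow> ('v \<Rightarrow> int) measure" where
  "label_measure T \<rho> =
     point_measure (verts T \<rightarrow>\<^sub>E {-1, 1}) (\<lambda>\<alpha>. ennreal (label_prob T \<rho> \<alpha>))"

text \<open>
  An outcome \<open>\<omega>\<close> assigns to each coordinate \<open>i < n\<close> the labelling \<open>\<omega> i\<close> of the vertices; the
  string at the vertex \<open>v\<close> reads off the labels of \<open>v\<close>.
\<close>

definition strings_measure :: "'v ugraph \<Rightarrow> real \<Rightarrow> nat \<Rightarrow> (nat \<Rightarrow> 'v \<Rightarrow> int) measure" where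
  "strings_measure T \<rho> n = (\<Pi>\<^sub>M i\<in>{..<n}. label_measure T \<rho>)"

definition string_at :: "nat \<Rightarrow> (nat \<Rightarrow> 'v \<Rightarrow> int) \<Rightarrow> 'v \<Rightarrow> nat \<Rightarrow> int" where
  "string_at n \<omega> v = (\<lambda>i\<in>{..<n}. \<omega> i v)"


section \<open>Protocols\<close>

definition cube :: "nat \<Rightarrow> (nat \<Rightarrow> int) set" where
  "cube n = {..<n} \<rightarrow>\<^sub>E {-1, 1}"

definition balanced :: "nat \<Rightarrow> ((nat \<Rightarrow> int) \<Rightarrow> int) \<Rightarrow> bool" where
  "balanced n f \<longleftrightarrow> f \<in> cube n \<rightarrow>\<^sub>E {-1, 1} \<and>
     card {x \<in> cube n. f x = 1} = 2 ^ (n - 1) \<and> card {x \<in> cube n. f x = -1} = 2 ^ (n - 1)"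

definition protocols :: "nat \<Rightarrow> 'v set \<Rightarrow> ('v \<Rightarrow> (nat \<Rightarrow> int) \<Rightarrow> int) set" where
  "protocols n S = S \<rightarrow>\<^sub>E {f. balanced n f}"

text \<open>
  Functions on the cube are extensional (see \<^const>\<open>balanced\<close>), so equality below is equality
  on the cube.
\<close>

definition simple_protocol :: "'v set \<Rightarrow> ('v \<Rightarrow> (nat \<Rightarrow> int) \<Rightarrow> int) \<Rightarrow> bool" where
  "simple_protocol S f \<longleftrightarrow> (\<forall>u\<in>S. \<forall>v\<in>S. f u = f v)"

definition agreement_prob ::
    "'v ugraph \<Rightarrow> real \<Rightarrow> nat \<Rightarrow> 'v set \<Rightarrow> ('v \<Rightarrow> (nat \<Rightarrow> int) \<Rightarrow> int) \<Rightarrow> real" where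
  "agreement_prob T \<rho> n S f =
     measure (strings_measure T \<rho> n)
       {\<omega> \<in> space (strings_measure T \<rho> n).
          \<forall>u\<in>S. \<forall>v\<in>S. f u (string_at n \<omega> u) = f v (string_at n \<omega> v)}"

definition sup_agreement_prob :: "'v ugraph \<Rightarrow> real \<Rightarrow> nat \<Rightarrow> 'v set \<Rightarrow> real" where
  "sup_agreement_prob T \<rho> n S = (SUP f\<in>protocols n S. agreement_prob T \<rho> n S f)"

definition optimal_protocol ::
    "'v ugraph \<Rightarrow> real \<Rightarrow> nat \<Rightarrow> 'v set \<Rightarrow> ('v \<Rightarrow> (nat \<Rightarrow> int) \<Rightarrow> int) \<Rightarrow> bool" where
  "optimal_protocol T \<rho> n S f \<longleftrightarrow>
     f \<in> protocols n S \<and> agreement_prob T \<rho> n S f = sup_agreement_prob T \<rho> n S"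


section \<open>A star with a path attached to its center\<close>

text \<open>
  The center is \<open>0\<close>, the leaves of the star are \<open>1, \<dots>, k\<^sub>1\<close>, and the path runs through
  \<open>0, k\<^sub>1 + 1, \<dots>, k\<^sub>1 + k\<^sub>2\<close>.
\<close>

definition path_vertex :: "nat \<Rightarrow> nat \<Rightarrow> nat" where
  "path_vertex k\<^sub>1 j = (if j = 0 then 0 else k\<^sub>1 + j)"

definition star_with_path :: "nat \<Rightarrow> nat \<Rightarrow> nat ugraph" where
  "star_with_path k\<^sub>1 k\<^sub>2 =
     \<lparr>verts = {0..k\<^sub>1 + k\<^sub>2},
      edges = (\<lambda>i. {0, i}) ` {1..k\<^sub>1} \<union>
              (\<lambda>j. {path_vertex k\<^sub>1 j, path_vertex k\<^sub>1 (Suc j)}) ` {..<k\<^sub>2}\<rparr>"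

end

theory Submission
  imports Defs
begin

text \<open>
  A large star and a long path favour different functions, and no single function serves both.

  Let \<open>N\<close> be the noise operator on the cube, which averages a function over the string at the other end of
  an edge, and let \<open>p = (1 + \<rho>) / 2\<close>. If the center and the path use the indicator \<open>a\<close> of a set
  of strings and the leaves the indicator \<open>b\<close>, then the probability that all strings lie in their
  sets is the mean of \<open>((a N) ^ k\<^sub>2 a) * (N b) ^ k\<^sub>1\<close> (lemma \<open>agreement_prob_star_with_path\<close>).

  A path favours dictators. For a set of density \<open>1/2\<close>, the probability that a walk of length
  \<open>k\<close> stays in the set is at most \<open>p ^ k / 2\<close>. Moreover, it is \<open>o(p ^ k)\<close> unless the set has
  \<open>N a = p\<close> at each of its points, as it does for dictators (lemma \<open>survival_dichotomy\<close>; this is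
  the heart of the proof, and it rests on \<open>N\<close> being self-adjoint and positive, fixing the
  constants, and having all its other eigenvalues at most \<open>\<rho>\<close>). In the exceptional case, a simple
  protocol has value exactly \<open>p ^ (k\<^sub>1 + k\<^sub>2) / 2\<close> for this value of the common bit. In all other
  cases it has at most this value once the path is long enough in terms of \<open>k\<^sub>1\<close>.

  A star with many leaves favours functions for which \<open>N b\<close> has a large maximum. For the majority
  of three bits, \<open>N b\<close> at the string of ones is \<open>q = 1/2 + (3 \<rho> - \<rho>\<^sup>3) / 4 > p\<close>. If the leaves use this
  function and all other vertices a dictator, then the value is at least
  \<open>q ^ k\<^sub>1 * p ^ k\<^sub>2 / 2 ^ n\<close>. It suffices to choose \<open>k\<^sub>1\<close> with \<open>(q / p) ^ k\<^sub>1 > 2 ^ n\<close>, and then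
  \<open>k\<^sub>2\<close> so large that no simple protocol exceeds \<open>p ^ (k\<^sub>1 + k\<^sub>2)\<close>.
\<close>

section \<open>The noise operator on the cube\<close>

definition mean :: "nat \<Rightarrow> ((nat \<Rightarrow> int) \<Rightarrow> real) \<Rightarrow> real" where
  "mean n g = (\<Sum>x\<in>cube n. g x) / 2 ^ n"

definition noise_kernel :: "nat \<Rightarrow> real \<Rightarrow> (nat \<Rightarrow> int) \<Rightarrow> (nat \<Rightarrow> int) \<Rightarrow> real" where
  "noise_kernel n \<rho> x y = (\<Prod>i<n. (1 + \<rho> * of_int (x i) * of_int (y i)) / 2)"

text \<open>
  The noise operator averages \<open>g\<close> over the string obtained from \<open>x\<close> by crossing one edge of the
  tree: each bit is kept with probability \<open>(1 + \<rho>) / 2\<close> and flipped otherwise.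
\<close>

definition noise :: "nat \<Rightarrow> real \<Rightarrow> ((nat \<Rightarrow> int) \<Rightarrow> real) \<Rightarrow> (nat \<Rightarrow> int) \<Rightarrow> real" where
  "noise n \<rho> g x = (\<Sum>y\<in>cube n. noise_kernel n \<rho> x y * g y)"

text \<open>
  The Walsh characters, which diagonalise the noise operator; they are evaluated only for
  \<open>U \<subseteq> {..<n}\<close>.
\<close>

definition walsh :: "nat set \<Rightarrow> (nat \<Rightarrow> int) \<Rightarrow> real" where
  "walsh U x = (\<Prod>i\<in>U. of_int (x i))"

definition fourier_coeff :: "nat \<Rightarrow> ((nat \<Rightarrow> int) \<Rightarrow> real) \<Rightarrow> nat set \<Rightarrow> real" where
  "fourier_coeff n g U = mean n (\<lambda>x. g x * walsh U x)"

lemma finite_cube [simp]: "finite (cube n)"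
  unfolding cube_def by (intro finite_PiE) auto

lemma card_cube: "card (cube n) = 2 ^ n"
  unfolding cube_def by (subst card_PiE) (auto simp: numeral_2_eq_2)

lemma cube_cases: "x \<in> cube n \<Longrightarrow> i < n \<Longrightarrow> x i = -1 \<or> x i = 1"
  unfolding cube_def by auto

lemma mean_add: "mean n (\<lambda>x. g x + h x) = mean n g + mean n h"
  and mean_diff: "mean n (\<lambda>x. g x - h x) = mean n g - mean n h"
  and mean_cmult: "mean n (\<lambda>x. c * g x) = c * mean n g"
  by (simp_all add: mean_def sum.distrib sum_subtractf sum_distrib_left add_divide_distrib
      diff_divide_distrib)

lemma mean_nonneg: "(\<And>x. x \<in> cube n \<Longrightarrow> 0 \<le> g x) \<Longrightarrow> 0 \<le> mean n g"
  unfolding mean_def by (intro divide_nonneg_nonneg sum_nonneg) auto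

lemma mean_mono: "(\<And>x. x \<in> cube n \<Longrightarrow> g x \<le> h x) \<Longrightarrow> mean n g \<le> mean n h"
  unfolding mean_def by (intro divide_right_mono sum_mono) auto

lemma mean_cong: "(\<And>x. x \<in> cube n \<Longrightarrow> g x = h x) \<Longrightarrow> mean n g = mean n h"
  unfolding mean_def by (simp cong: sum.cong)

lemma noise_kernel_nonneg:
  assumes "0 \<le> \<rho>" "\<rho> \<le> 1" "x \<in> cube n" "y \<in> cube n"
  shows "0 \<le> noise_kernel n \<rho> x y"
  unfolding noise_kernel_def
proof (intro prod_nonneg)
  fix i assume "i \<in> {..<n}"
  then have "x i = -1 \<or> x i = 1" "y i = -1 \<or> y i = 1" using assms cube_cases by auto
  then show "0 \<le> (1 + \<rho> * of_int (x i) * of_int (y i)) / 2"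
    using assms(1,2) by auto
qed

lemma noise_nonneg:
  assumes "0 \<le> \<rho>" "\<rho> \<le> 1" "x \<in> cube n" "\<And>y. y \<in> cube n \<Longrightarrow> 0 \<le> g y"
  shows "0 \<le> noise n \<rho> g x"
  unfolding noise_def using assms by (intro sum_nonneg mult_nonneg_nonneg noise_kernel_nonneg) auto

lemma noise_linear:
  "noise n \<rho> (\<lambda>x. g x + h x) x = noise n \<rho> g x + noise n \<rho> h x"
  "noise n \<rho> (\<lambda>x. g x - h x) x = noise n \<rho> g x - noise n \<rho> h x"
  "noise n \<rho> (\<lambda>x. c * g x) x = c * noise n \<rho> g x"
  by (simp_all add: noise_def sum.distrib sum_subtractf sum_distrib_left algebra_simps)

lemma noise_cong: "(\<And>y. y \<in> cube n \<Longrightarrow> g y = h y) \<Longrightarrow> noise n \<rho> g = noise n \<rho> h"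
  unfolding noise_def by (simp cong: sum.cong)

text \<open>
  Both the kernel and the character are products over the coordinates, so the sum over the cube is
  a product of sums over \<open>{-1, 1}\<close>; a coordinate in \<open>U\<close> contributes \<open>\<rho> x\<^sub>i\<close>, any other one
  contributes \<open>1\<close>.
\<close>

lemma noise_walsh:
  assumes "U \<subseteq> {..<n}"
  shows "noise n \<rho> (walsh U) x = \<rho> ^ card U * walsh U x"
proof -
  have fin: "finite U" using assms finite_subset by blast
  have walsh: "walsh U y = (\<Prod>i<n. if i \<in> U then of_int (y i) else 1)" for y
    unfolding walsh_def using assms
    by (subst prod.inter_restrict[symmetric]) (auto simp: Int_absorb1)
  have "noise n \<rho> (walsh U) x =
      (\<Sum>y\<in>cube n. \<Prod>i<n. (1 + \<rho> * of_int (x i) * of_int (y i)) / 2 * (if i \<in> U then of_int (y i) else 1))"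
    unfolding noise_def noise_kernel_def walsh prod.distrib by (rule refl)
  also have "\<dots> = (\<Prod>i<n. \<Sum>y\<in>{-1,1::int}.
      (1 + \<rho> * of_int (x i) * of_int y) / 2 * (if i \<in> U then of_int y else 1))"
    unfolding cube_def by (subst prod_sum_PiE) auto
  also have "\<dots> = (\<Prod>i<n. if i \<in> U then \<rho> * of_int (x i) else 1)"
    by (intro prod.cong) (auto simp: field_simps)
  also have "\<dots> = (\<Prod>i\<in>U. \<rho> * of_int (x i))"
    using assms by (subst prod.inter_restrict[symmetric]) (auto simp: Int_absorb1)
  finally show ?thesis by (simp add: walsh_def prod.distrib)
qed

lemma noise_one [simp]: "noise n \<rho> (\<lambda>_. 1) x = 1"
  using noise_walsh[of "{}" n \<rho> x] by (simp add: walsh_def[abs_def])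

lemma noise_le_one:
  assumes "0 \<le> \<rho>" "\<rho> \<le> 1" "x \<in> cube n" "\<And>y. y \<in> cube n \<Longrightarrow> g y \<le> 1"
  shows "noise n \<rho> g x \<le> 1"
proof -
  have "noise n \<rho> g x \<le> noise n \<rho> (\<lambda>_. 1) x"
    unfolding noise_def using assms by (intro sum_mono mult_left_mono noise_kernel_nonneg) auto
  then show ?thesis by simp
qed

lemma noise_kernel_fourier:
  "noise_kernel n \<rho> x y = (\<Sum>U\<in>Pow {..<n}. \<rho> ^ card U * walsh U x * walsh U y) / 2 ^ n"
proof -
  have "noise_kernel n \<rho> x y = (\<Prod>i<n. \<rho> * of_int (x i) * of_int (y i) + 1) / 2 ^ n"
    by (simp add: noise_kernel_def prod_dividef add.commute)
  also have "(\<Prod>i<n. \<rho> * of_int (x i) * of_int (y i) + 1) =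
      (\<Sum>U\<in>Pow {..<n}. \<rho> ^ card U * walsh U x * walsh U y)"
    by (subst prod_add) (auto simp: walsh_def prod.distrib)
  finally show ?thesis .
qed

lemma noise_fourier:
  "noise n \<rho> h x = (\<Sum>U\<in>Pow {..<n}. \<rho> ^ card U * fourier_coeff n h U * walsh U x)"
proof -
  have "noise n \<rho> h x = (\<Sum>y\<in>cube n. \<Sum>U\<in>Pow {..<n}. \<rho> ^ card U * walsh U x * walsh U y / 2 ^ n * h y)"
    by (simp only: noise_def noise_kernel_fourier sum_divide_distrib sum_distrib_right)
  also have "\<dots> = (\<Sum>U\<in>Pow {..<n}. \<Sum>y\<in>cube n. \<rho> ^ card U * walsh U x * walsh U y / 2 ^ n * h y)"
    by (rule sum.swap)
  also have "\<dots> = (\<Sum>U\<in>Pow {..<n}. \<rho> ^ card U * fourier_coeff n h U * walsh U x)"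
    unfolding fourier_coeff_def mean_def sum_divide_distrib sum_distrib_left sum_distrib_right
    by (intro sum.cong refl) simp
  finally show ?thesis .
qed

lemma mean_noise_fourier:
  "mean n (\<lambda>x. g x * noise n \<rho> h x) =
     (\<Sum>U\<in>Pow {..<n}. \<rho> ^ card U * fourier_coeff n g U * fourier_coeff n h U)"
proof -
  have "mean n (\<lambda>x. g x * noise n \<rho> h x) =
      (\<Sum>x\<in>cube n. \<Sum>U\<in>Pow {..<n}. g x * (\<rho> ^ card U * fourier_coeff n h U * walsh U x) / 2 ^ n)"
    by (simp only: mean_def noise_fourier sum_divide_distrib sum_distrib_left)
  also have "\<dots> = (\<Sum>U\<in>Pow {..<n}. \<Sum>x\<in>cube n. g x * (\<rho> ^ card U * fourier_coeff n h U * walsh U x) / 2 ^ n)"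
    by (rule sum.swap)
  also have "\<dots> = (\<Sum>U\<in>Pow {..<n}. \<Sum>x\<in>cube n. \<rho> ^ card U * (g x * walsh U x / 2 ^ n) * fourier_coeff n h U)"
    by (intro sum.cong refl) simp
  also have "\<dots> = (\<Sum>U\<in>Pow {..<n}. \<rho> ^ card U * fourier_coeff n g U * fourier_coeff n h U)"
    by (simp only: fourier_coeff_def[of n g] mean_def sum_divide_distrib sum_distrib_left sum_distrib_right)
  finally show ?thesis .
qed

lemma noise_self_adjoint: "mean n (\<lambda>x. g x * noise n \<rho> h x) = mean n (\<lambda>x. noise n \<rho> g x * h x)"
proof -
  have "mean n (\<lambda>x. noise n \<rho> g x * h x) = mean n (\<lambda>x. h x * noise n \<rho> g x)"
    by (simp add: mult.commute)
  then show ?thesis by (simp add: mean_noise_fourier mult_ac)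
qed

text \<open>
  Without noise the kernel is the identity. This makes Parseval's identity the case \<open>\<rho> = 1\<close> of the
  Fourier expansion of the quadratic form of the noise operator.
\<close>

lemma noise_id:
  assumes "x \<in> cube n"
  shows "noise n 1 g x = g x"
proof -
  have "noise_kernel n 1 x y = of_bool (y = x)" if "y \<in> cube n" for y
  proof (cases "y = x")
    case True
    have "(1 + of_int (x i) * of_int (x i)) / 2 = (1::real)" if "i < n" for i
      using cube_cases[OF assms that] by auto
    with True show ?thesis by (simp add: noise_kernel_def)
  next
    case False
    then obtain i where i: "i < n" "x i \<noteq> y i"
      using assms \<open>y \<in> cube n\<close> unfolding cube_def by (metis PiE_ext lessThan_iff)
    then have "(1 + of_int (x i) * of_int (y i)) / 2 = (0::real)"
      using cube_cases[OF assms i(1)] cube_cases[OF \<open>y \<in> cube n\<close> i(1)] by auto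
    with i(1) False show ?thesis by (auto simp: noise_kernel_def)
  qed
  then have "noise n 1 g x = (\<Sum>y\<in>cube n. if y = x then g y else 0)"
    unfolding noise_def by (intro sum.cong) auto
  then show ?thesis using assms by simp
qed

lemma parseval: "mean n (\<lambda>x. (g x)\<^sup>2) = (\<Sum>U\<in>Pow {..<n}. (fourier_coeff n g U)\<^sup>2)"
proof -
  have "mean n (\<lambda>x. (g x)\<^sup>2) = mean n (\<lambda>x. g x * noise n 1 g x)"
    by (intro mean_cong) (simp add: noise_id power2_eq_square)
  then show ?thesis by (simp add: mean_noise_fourier power2_eq_square)
qed

text \<open>
  All eigenvalues of the noise operator except the one of the constant function are at most
  \<open>\<rho>\<close>, and the constant component of \<open>g\<close> is its mean.
\<close>

lemma noise_spectral_gap: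
  assumes "0 \<le> \<rho>" "\<rho> \<le> 1"
  shows "mean n (\<lambda>x. g x * noise n \<rho> g x) \<le> \<rho> * mean n (\<lambda>x. (g x)\<^sup>2) + (1 - \<rho>) * (mean n g)\<^sup>2"
proof -
  let ?c = "fourier_coeff n g"
  have zero: "?c {} = mean n g" by (simp add: fourier_coeff_def walsh_def)
  have "mean n (\<lambda>x. g x * noise n \<rho> g x) \<le>
      (\<Sum>U\<in>Pow {..<n}. \<rho> * (?c U)\<^sup>2 + (if U = {} then (1 - \<rho>) * (?c U)\<^sup>2 else 0))"
    unfolding mean_noise_fourier
  proof (intro sum_mono)
    fix U assume "U \<in> Pow {..<n}"
    then have "finite U" using finite_subset by auto
    then have "U \<noteq> {} \<Longrightarrow> \<rho> ^ card U \<le> \<rho>"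
      using assms power_decreasing[of 1 "card U" \<rho>] by (simp add: Suc_leI card_gt_0_iff)
    then have "U \<noteq> {} \<Longrightarrow> \<rho> ^ card U * (?c U)\<^sup>2 \<le> \<rho> * (?c U)\<^sup>2"
      by (intro mult_right_mono) auto
    then show "\<rho> ^ card U * ?c U * ?c U \<le> \<rho> * (?c U)\<^sup>2 + (if U = {} then (1 - \<rho>) * (?c U)\<^sup>2 else 0)"
      by (auto simp: power2_eq_square algebra_simps)
  qed
  also have "\<dots> = \<rho> * mean n (\<lambda>x. (g x)\<^sup>2) + (1 - \<rho>) * (mean n g)\<^sup>2"
    by (simp add: sum.distrib parseval sum_distrib_left flip: zero)
  finally show ?thesis .
qed

text \<open>
  The quadratic form of the noise operator is positive semidefinite because its eigenvalues
  \<open>\<rho> ^ card U\<close> are nonnegative.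
\<close>

lemma noise_cauchy_schwarz:
  assumes "0 \<le> \<rho>"
  shows "(mean n (\<lambda>x. g x * noise n \<rho> h x))\<^sup>2
     \<le> mean n (\<lambda>x. g x * noise n \<rho> g x) * mean n (\<lambda>x. h x * noise n \<rho> h x)"
proof -
  let ?w = "\<lambda>U. sqrt (\<rho> ^ card U)"
  have sq: "?w U * ?w U = \<rho> ^ card U" for U using assms by simp
  have *: "mean n (\<lambda>x. g x * noise n \<rho> h x) =
      (\<Sum>U\<in>Pow {..<n}. (?w U * fourier_coeff n g U) * (?w U * fourier_coeff n h U))" for g h
    unfolding mean_noise_fourier
  proof (intro sum.cong refl)
    fix U
    have "(?w U * fourier_coeff n g U) * (?w U * fourier_coeff n h U) =
        (?w U * ?w U) * fourier_coeff n g U * fourier_coeff n h U" by (simp only: mult_ac)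
    then show "\<rho> ^ card U * fourier_coeff n g U * fourier_coeff n h U =
        (?w U * fourier_coeff n g U) * (?w U * fourier_coeff n h U)" by (simp only: sq)
  qed
  show ?thesis
    unfolding * using Cauchy_Schwarz_ineq_sum[of "\<lambda>U. ?w U * fourier_coeff n g U" 
        "\<lambda>U. ?w U * fourier_coeff n h U" "Pow {..<n}"]
    by (simp only: power2_eq_square)
qed

lemma mean_cauchy_schwarz:
  "(mean n (\<lambda>x. g x * h x))\<^sup>2 \<le> mean n (\<lambda>x. (g x)\<^sup>2) * mean n (\<lambda>x. (h x)\<^sup>2)"
  unfolding mean_def
  using Cauchy_Schwarz_ineq_sum[of g h "cube n"]
  by (simp add: power_divide power2_eq_square divide_right_mono)

section \<open>Walks confined to a set\<close>

text \<open>
  For an indicator \<open>a\<close> of a set, this is the probability that a noisy walk started at \<open>x\<close> lies in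
  the set at each of the times \<open>0, \<dots>, k\<close>. In operator terms it is \<open>(a N)\<^sup>k a\<close> with the noise
  operator \<open>N\<close> and multiplication by \<open>a\<close>.
\<close>

fun survival :: "nat \<Rightarrow> real \<Rightarrow> ((nat \<Rightarrow> int) \<Rightarrow> real) \<Rightarrow> nat \<Rightarrow> (nat \<Rightarrow> int) \<Rightarrow> real" where
  "survival n \<rho> a 0 x = a x"
| "survival n \<rho> a (Suc k) x = a x * noise n \<rho> (survival n \<rho> a k) x"

lemma survival_zero: "survival n \<rho> a 0 = a"
  by (rule ext) simp

lemma survival_nonneg:
  assumes "0 \<le> \<rho>" "\<rho> \<le> 1" "\<And>x. x \<in> cube n \<Longrightarrow> 0 \<le> a x" "x \<in> cube n"
  shows "0 \<le> survival n \<rho> a k x"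
  using assms(4) by (induction k arbitrary: x) (auto intro!: mult_nonneg_nonneg noise_nonneg assms)

lemma survival_const:
  assumes "\<And>x. x \<in> cube n \<Longrightarrow> a x * noise n \<rho> a x = \<kappa> * a x" "x \<in> cube n"
  shows "survival n \<rho> a k x = \<kappa> ^ k * a x"
  using assms(2)
proof (induction k arbitrary: x)
  case (Suc k)
  have "noise n \<rho> (survival n \<rho> a k) = noise n \<rho> (\<lambda>x. \<kappa> ^ k * a x)"
    by (intro noise_cong Suc)
  then have "survival n \<rho> a (Suc k) x = \<kappa> ^ k * (a x * noise n \<rho> a x)"
    by (simp add: noise_linear)
  then show ?case using assms(1)[OF Suc.prems] by (simp only: power_Suc mult_ac)
qed simp

lemma survival_absorb:
  assumes "a x = 0 \<or> a x = 1"
  shows "a x * survival n \<rho> a k x = survival n \<rho> a k x"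
  using assms by (cases k) auto

lemma mean_survival_noise:
  assumes "\<And>x. x \<in> cube n \<Longrightarrow> a x = 0 \<or> a x = 1"
  shows "mean n (\<lambda>x. survival n \<rho> a i x * noise n \<rho> (survival n \<rho> a j) x) =
    mean n (\<lambda>x. survival n \<rho> a i x * survival n \<rho> a (Suc j) x)"
proof (intro mean_cong)
  fix x assume "x \<in> cube n"
  then show "survival n \<rho> a i x * noise n \<rho> (survival n \<rho> a j) x =
      survival n \<rho> a i x * survival n \<rho> a (Suc j) x"
    using assms[of x] survival_absorb[of a x n \<rho> i] by auto
qed

text \<open>
  The walk is reversible: two independent confined walks of lengths \<open>i\<close> and \<open>j\<close> from a common
  starting point form one confined walk of length \<open>i + j\<close>.
\<close>

lemma mean_survival_mult:
  assumes "\<And>x. x \<in> cube n \<Longrightarrow> a x = 0 \<or> a x = 1"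
  shows "mean n (\<lambda>x. survival n \<rho> a i x * survival n \<rho> a j x) = mean n (survival n \<rho> a (i + j))"
proof (induction i arbitrary: j)
  case 0
  show ?case by (intro mean_cong) (simp add: survival_absorb assms)
next
  case (Suc i)
  have "mean n (\<lambda>x. survival n \<rho> a (Suc i) x * survival n \<rho> a j x) =
      mean n (\<lambda>x. survival n \<rho> a j x * survival n \<rho> a (Suc i) x)"
    by (simp only: mult.commute)
  also have "\<dots> = mean n (\<lambda>x. survival n \<rho> a j x * noise n \<rho> (survival n \<rho> a i) x)"
    using assms by (rule mean_survival_noise[symmetric])
  also have "\<dots> = mean n (\<lambda>x. noise n \<rho> (survival n \<rho> a j) x * survival n \<rho> a i x)"
    by (rule noise_self_adjoint)
  also have "\<dots> = mean n (\<lambda>x. survival n \<rho> a i x * noise n \<rho> (survival n \<rho> a j) x)"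
    by (simp only: mult.commute)
  also have "\<dots> = mean n (\<lambda>x. survival n \<rho> a i x * survival n \<rho> a (Suc j) x)"
    using assms by (rule mean_survival_noise)
  also have "\<dots> = mean n (survival n \<rho> a (i + Suc j))" by (rule Suc)
  finally show ?case by (simp only: add_Suc add_Suc_right)
qed

text \<open>
  Let \<open>\<mu>\<close> be the density of the set, \<open>b k\<close> the probability of surviving \<open>k\<close> steps from a uniform
  start, and \<open>c k = b k / \<kappa>\<^sup>k\<close>. Splitting a walk in the middle and using the spectral gap and
  Cauchy--Schwarz shows that \<open>c\<close> is nonincreasing, starting from \<open>c 0 = \<mu>\<close>. In the limit the
  spectral gap inequality becomes quadratic in \<open>l = lim c\<close>, namely \<open>l (\<mu> - l) \<le> 0\<close>, so that
  \<open>l = 0\<close> or \<open>l = \<mu>\<close>. In the second case \<open>c\<close> is constant, and then \<open>b 0, b 1, b 2\<close> are the moments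
  of a one-step survival probability with variance zero on the set.
\<close>

lemma survival_dichotomy:
  fixes n :: nat and \<rho> :: real and a :: "(nat \<Rightarrow> int) \<Rightarrow> real"
  defines "\<kappa> \<equiv> \<rho> + (1 - \<rho>) * mean n a"
  assumes \<rho>: "0 < \<rho>" "\<rho> < 1"
    and a: "\<And>x. x \<in> cube n \<Longrightarrow> a x = 0 \<or> a x = 1"
  shows "(\<forall>x\<in>cube n. a x * noise n \<rho> a x = \<kappa> * a x) \<or>
    (\<lambda>k. mean n (survival n \<rho> a k) / \<kappa> ^ k) \<longlonglongrightarrow> 0"
proof -
  define b where "b k = mean n (survival n \<rho> a k)" for k
  define \<mu> where "\<mu> = mean n a"
  have \<kappa>_eq: "\<kappa> = \<rho> + (1 - \<rho>) * \<mu>" by (simp add: \<kappa>_def \<mu>_def)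
  have a_nonneg: "0 \<le> a x" if "x \<in> cube n" for x using a[OF that] by auto
  have b_nonneg: "0 \<le> b k" for k
    unfolding b_def using \<rho> a_nonneg by (intro mean_nonneg survival_nonneg) auto
  have b0: "b 0 = \<mu>" unfolding b_def \<mu>_def by (intro mean_cong) simp
  have "0 \<le> \<mu>" using b_nonneg[of 0] b0 by simp
  then have \<kappa>: "0 < \<kappa>" unfolding \<kappa>_eq using \<rho> by (simp add: add_pos_nonneg)
  have sq: "mean n (\<lambda>x. (survival n \<rho> a k x)\<^sup>2) = b (2 * k)" for k
    using mean_survival_mult[OF a, where i=k and j=k] by (simp add: b_def power2_eq_square mult_2)
  have noise_b: "mean n (\<lambda>x. survival n \<rho> a i x * noise n \<rho> (survival n \<rho> a j) x) = b (Suc (i + j))" for i j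
    using mean_survival_noise[of n a \<rho> i j, OF a] mean_survival_mult[of n a \<rho> i "Suc j", OF a]
    unfolding b_def add_Suc_right by (rule trans)
  have cs: "(b k)\<^sup>2 \<le> \<mu> * b (2 * k)" for k
  proof -
    have "b k = mean n (\<lambda>x. survival n \<rho> a 0 x * survival n \<rho> a k x)"
      unfolding b_def using mean_survival_mult[OF a, where i = 0 and j = k] by simp
    then show ?thesis
      using mean_cauchy_schwarz[of n "survival n \<rho> a 0" "survival n \<rho> a k"] unfolding sq b0[symmetric]
      by simp
  qed
  have gap: "b (Suc (2 * k)) \<le> \<rho> * b (2 * k) + (1 - \<rho>) * (b k)\<^sup>2" for k
    using noise_spectral_gap[of \<rho> n "survival n \<rho> a k"] \<rho>
    unfolding sq noise_b by (simp add: b_def mult_2)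
  \<comment> \<open>A walk of odd length is an edge between two walks of equal length; the spectral gap applies.\<close>
  have even_step: "b (Suc (2 * k)) \<le> \<kappa> * b (2 * k)" for k
  proof -
    have "(1 - \<rho>) * (b k)\<^sup>2 \<le> (1 - \<rho>) * (\<mu> * b (2 * k))" using cs \<rho> by (intro mult_left_mono) auto
    then show ?thesis using gap[of k] by (simp add: \<kappa>_eq algebra_simps)
  qed
  \<comment> \<open>Log-convexity of the survival probabilities carries the bound over to even lengths.\<close>
  have odd_step: "b (2 * k + 2) \<le> \<kappa> * b (2 * k + 1)" for k
  proof (cases "b (2 * k + 2) = 0")
    case True
    then show ?thesis using b_nonneg \<kappa> by simp
  next
    case False
    have "(b (2 * k + 2))\<^sup>2 \<le> b (2 * k + 3) * b (2 * k + 1)"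
      using noise_cauchy_schwarz[of \<rho> n "survival n \<rho> a (Suc k)" "survival n \<rho> a k"] \<rho>
      unfolding noise_b 
      by (simp add: b_def mult_2 numeral_eq_Suc)
    also have "\<dots> \<le> (\<kappa> * b (2 * k + 2)) * b (2 * k + 1)"
      using even_step[of "Suc k"] b_nonneg by (intro mult_right_mono) (simp_all add: numeral_eq_Suc)
    finally have "b (2 * k + 2) * b (2 * k + 2) \<le> b (2 * k + 2) * (\<kappa> * b (2 * k + 1))"
      by (simp add: power2_eq_square mult_ac)
    then show ?thesis using False b_nonneg[of "2 * k + 2"] by (subst (asm) mult_le_cancel_left_pos) auto
  qed
  have step: "b (Suc m) \<le> \<kappa> * b m" for m
    using even_step[of "m div 2"] odd_step[of "m div 2"] by (cases "even m") (auto elim!: evenE oddE)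
  define c where "c k = b k / \<kappa> ^ k" for k
  have dec: "decseq c"
    unfolding c_def using step \<kappa> by (intro decseq_SucI) (simp add: field_simps)
  have c_nonneg: "0 \<le> c k" for k unfolding c_def using b_nonneg \<kappa> by simp
  obtain l where l: "c \<longlonglongrightarrow> l" and le: "\<And>k. l \<le> c k"
    using decseq_convergent[OF dec, of 0] c_nonneg by blast
  have l_nonneg: "0 \<le> l" using l c_nonneg by (meson LIMSEQ_le_const)
  have gap_c: "\<kappa> * c (2 * k + 1) \<le> \<rho> * c (2 * k) + (1 - \<rho>) * (c k)\<^sup>2" for k
  proof -
    have "\<kappa> * c (2 * k + 1) = b (2 * k + 1) / \<kappa> ^ (2 * k)" using \<kappa> by (simp add: c_def)
    also have "\<dots> \<le> (\<rho> * b (2 * k) + (1 - \<rho>) * (b k)\<^sup>2) / \<kappa> ^ (2 * k)"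
      using gap[of k] \<kappa> by (intro divide_right_mono) auto
    also have "\<dots> = \<rho> * c (2 * k) + (1 - \<rho>) * (c k)\<^sup>2"
      by (simp add: c_def add_divide_distrib power_divide mult.commute flip: power_mult)
    finally show ?thesis .
  qed
  have lim_even: "(\<lambda>k. c (2 * k)) \<longlonglongrightarrow> l"
    using LIMSEQ_subseq_LIMSEQ[OF l, of "\<lambda>k. 2 * k"] by (simp add: strict_mono_def o_def)
  have lim_odd: "(\<lambda>k. c (2 * k + 1)) \<longlonglongrightarrow> l"
    using LIMSEQ_subseq_LIMSEQ[OF l, of "\<lambda>k. 2 * k + 1"] by (simp add: strict_mono_def o_def)
  have "\<kappa> * l \<le> \<rho> * l + (1 - \<rho>) * l\<^sup>2"
    by (rule LIMSEQ_le[where X = "\<lambda>k. \<kappa> * c (2 * k + 1)"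
          and Y = "\<lambda>k. \<rho> * c (2 * k) + (1 - \<rho>) * (c k)\<^sup>2"])
      (use gap_c in \<open>auto intro!: tendsto_intros lim_even lim_odd l simp del: One_nat_def\<close>)
  then have "(1 - \<rho>) * (l * (\<mu> - l)) \<le> 0" by (simp add: \<kappa>_eq power2_eq_square algebra_simps)
  then have "l * (\<mu> - l) \<le> 0" using \<rho> by (simp add: mult_le_0_iff)
  then consider "l = 0" | "\<mu> \<le> l" using l_nonneg by (auto simp: mult_le_0_iff)
  then show ?thesis
  proof cases
    case 1
    then show ?thesis using l unfolding c_def[abs_def] b_def by simp
  next
    case 2
    have c_eq: "c k = \<mu>" for k
      using decseqD[OF dec, of 0 k] le[of k] 2 b0 by (simp add: c_def)
    have b1: "b 1 = \<kappa> * \<mu>" and b2: "b 2 = \<kappa>\<^sup>2 * \<mu>"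
      using c_eq[of 1] c_eq[of 2] \<kappa> by (simp_all add: c_def field_simps)
    have cross: "mean n (\<lambda>x. survival n \<rho> a 0 x * survival n \<rho> a 1 x) = b 1"
      using mean_survival_mult[of n a \<rho> 0 1, OF a] by (simp only: b_def add_0)
    \<comment> \<open>The squared distance of the one-step survival probability from its mean \<open>\<kappa>\<close> on the set vanishes.\<close>
    let ?d = "\<lambda>x. survival n \<rho> a 1 x - \<kappa> * a x"
    have "mean n (\<lambda>x. (?d x)\<^sup>2) =
        mean n (\<lambda>x. (survival n \<rho> a 1 x)\<^sup>2 - 2 * \<kappa> * (survival n \<rho> a 0 x * survival n \<rho> a 1 x) + \<kappa>\<^sup>2 * (survival n \<rho> a 0 x)\<^sup>2)"
      by (intro mean_cong) (simp add: power2_diff power_mult_distrib algebra_simps)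
    also have "\<dots> = b 2 - 2 * \<kappa> * b 1 + \<kappa>\<^sup>2 * b 0"
      unfolding mean_add mean_diff mean_cmult sq cross by simp
    also have "\<dots> = 0" unfolding b0 b1 b2 by (simp add: power2_eq_square)
    finally have "\<forall>x\<in>cube n. (?d x)\<^sup>2 = 0"
      by (simp add: mean_def sum_nonneg_eq_0_iff)
    then show ?thesis by (simp add: survival_zero)
  qed
qed

section \<open>Trees in which every vertex has a smaller parent\<close>

text \<open>
  Vertex \<open>0\<close> is the root and every other vertex \<open>i\<close> has one edge to \<open>par i < i\<close>. This form gives a
  product over the vertices \<open>1, \<dots>, N\<close> for the edge weights and allows the vertices to be summed
  out one at a time from the largest down.
\<close>

definition parent_tree :: "(nat \<Rightarrow> nat) \<Rightarrow> nat \<Rightarrow> nat ugraph" where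
  "parent_tree par N = \<lparr>verts = {0..N}, edges = (\<lambda>i. {par i, i}) ` {1..N}\<rparr>"

lemma parent_edge_iff:
  assumes "\<And>i. i \<in> {1..N} \<Longrightarrow> par i < i" "u \<le> v"
  shows "{u, v} \<in> edges (parent_tree par N) \<longleftrightarrow> v \<in> {1..N} \<and> u = par v"
proof
  assume "{u, v} \<in> edges (parent_tree par N)"
  then obtain i where i: "i \<in> {1..N}" "{u, v} = {par i, i}" by (auto simp: parent_tree_def)
  moreover have "par i < i" using assms(1) i(1) .
  ultimately have "u = par i \<and> v = i" using assms(2) by (auto simp: doubleton_eq_iff)
  with i show "v \<in> {1..N} \<and> u = par v" by simp
qed (auto simp: parent_tree_def)

lemma inj_on_parent_edge:
  assumes "\<And>i. i \<in> {1..N} \<Longrightarrow> par i < (i::nat)"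
  shows "inj_on (\<lambda>i. {par i, i}) {1..N}"
proof (rule inj_onI)
  fix i j assume "i \<in> {1..N}" "j \<in> {1..N}" "{par i, i} = {par j, j}"
  then show "i = j" using assms[of i] assms[of j] by (auto simp: doubleton_eq_iff)
qed

text \<open>
  Connectedness holds because iterated parents reach the root. On a cycle, the largest vertex
  would have two distinct smaller neighbours, but its parent is the only one.
\<close>

lemma finite_tree_parent_tree:
  assumes par: "\<And>i. i \<in> {1..N} \<Longrightarrow> par i < i"
  shows "finite_tree (parent_tree par N)"
proof -
  let ?T = "parent_tree par N"
  have simple: "finite_simple_graph ?T"
  proof -
    have "{par i, i} \<subseteq> {0..N} \<and> card {par i, i} = 2" if "i \<in> {1..N}" for i
      using par[OF that] that by (auto simp: card_insert_if)
    then show ?thesis by (auto simp: finite_simple_graph_def parent_tree_def)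
  qed
  have sym: "sym (adjacency ?T)"
    by (auto simp: sym_def adjacency_def insert_commute)
  have root: "(v, 0) \<in> (adjacency ?T)\<^sup>*" if "v \<le> N" for v
    using that
  proof (induction v rule: less_induct)
    case (less v)
    show ?case
    proof (cases "v = 0")
      case False
      then have v: "v \<in> {1..N}" using less.prems by auto
      then have "(v, par v) \<in> adjacency ?T"
        by (auto simp: adjacency_def parent_tree_def insert_commute)
      moreover have "(par v, 0) \<in> (adjacency ?T)\<^sup>*"
        using par[OF v] less by auto
      ultimately show ?thesis by (rule converse_rtrancl_into_rtrancl)
    qed auto
  qed
  have "(u, v) \<in> (adjacency ?T)\<^sup>*" if "u \<le> N" "v \<le> N" for u v
    using root[OF that(1)] symD[OF sym_rtrancl[OF sym] root[OF that(2)]] by (rule rtrancl_trans)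
  then have conn: "connected_graph ?T"
    by (auto simp: connected_graph_def parent_tree_def)
  have "\<not> graph_cycle ?T p" for p
  proof
    assume "graph_cycle ?T p"
    then have len: "3 \<le> length p" and dist: "distinct p"
      and edge: "\<And>i. i < length p \<Longrightarrow> {p ! i, p ! (Suc i mod length p)} \<in> edges ?T"
      by (auto simp: graph_cycle_def)
    have "Max (set p) \<in> set p" using len by (intro Max_in) auto
    then obtain j where j: "j < length p" "p ! j = Max (set p)" by (auto simp: in_set_conv_nth)
    have le: "p ! i \<le> p ! j" if "i < length p" for i using that j by simp
    define s where "s = Suc j mod length p"
    define t where "t = (if j = 0 then length p - 1 else j - 1)"
    have "0 < length p" using len by linarith
    then have s: "s < length p" unfolding s_def by (rule mod_less_divisor)
    have t: "t < length p" unfolding t_def using j len by auto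
    have ts: "Suc t mod length p = j" using j len by (auto simp: t_def)
    have "s \<noteq> t" using j len by (auto simp: s_def t_def mod_Suc split: if_splits)
    have "{p ! s, p ! j} \<in> edges ?T" using edge[OF j(1)] by (simp add: s_def insert_commute)
    then have "p ! s = par (p ! j)" using parent_edge_iff[OF par le[OF s]] by simp
    moreover have "{p ! t, p ! j} \<in> edges ?T" using edge[OF t] by (simp add: ts)
    then have "p ! t = par (p ! j)" using parent_edge_iff[OF par le[OF t]] by simp
    ultimately show False using nth_eq_iff_index_eq[OF dist s t] \<open>s \<noteq> t\<close> by simp
  qed
  with simple conn show ?thesis by (auto simp: finite_tree_def)
qed

text \<open>
  An edge has weight \<open>(1 + \<rho> \<alpha>\<^sub>u \<alpha>\<^sub>v) / 2\<close>, whether its endpoints agree or not.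
\<close>

lemma label_prob_parent_tree:
  assumes par: "\<And>i. i \<in> {1..N} \<Longrightarrow> par i < i"
    and \<alpha>: "\<And>i. i \<in> {0..N} \<Longrightarrow> \<alpha> i = -1 \<or> \<alpha> i = (1::int)"
  shows "label_prob (parent_tree par N) \<rho> \<alpha> =
    1/2 * (\<Prod>i\<in>{1..N}. (1 + \<rho> * of_int (\<alpha> (par i)) * of_int (\<alpha> i)) / 2)"
proof -
  let ?e = "\<lambda>i. {par i, i}"
  let ?A = "{i \<in> {1..N}. \<alpha> (par i) = \<alpha> i}" and ?D = "{i \<in> {1..N}. \<alpha> (par i) \<noteq> \<alpha> i}"
  have A_eq: "?A = {1..N} \<inter> {i. \<alpha> (par i) = \<alpha> i}" and D_eq: "?D = {1..N} \<inter> - {i. \<alpha> (par i) = \<alpha> i}"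
    by auto
  have inj: "inj_on ?e ?A" "inj_on ?e ?D"
    by (rule inj_on_subset[OF inj_on_parent_edge[OF par]]; auto)+
  have "agreeing_edges (parent_tree par N) \<alpha> = ?e ` ?A"
  proof -
    have "(\<forall>u\<in>?e i. \<forall>v\<in>?e i. \<alpha> u = \<alpha> v) \<longleftrightarrow> \<alpha> (par i) = \<alpha> i" for i by auto
    then show ?thesis by (auto simp only: agreeing_edges_def parent_tree_def ugraph.simps)
  qed
  then have agree: "card (agreeing_edges (parent_tree par N) \<alpha>) = card ?A"
    by (simp only: card_image[OF inj(1)])
  have "disagreeing_edges (parent_tree par N) \<alpha> = ?e ` ?D"
  proof -
    have "(\<exists>u\<in>?e i. \<exists>v\<in>?e i. \<alpha> u \<noteq> \<alpha> v) \<longleftrightarrow> \<alpha> (par i) \<noteq> \<alpha> i" for i by auto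
    then show ?thesis by (auto simp only: disagreeing_edges_def parent_tree_def ugraph.simps)
  qed
  then have disagree: "card (disagreeing_edges (parent_tree par N) \<alpha>) = card ?D"
    by (simp only: card_image[OF inj(2)])
  have "(\<Prod>i\<in>{1..N}. (1 + \<rho> * of_int (\<alpha> (par i)) * of_int (\<alpha> i)) / 2) =
      (\<Prod>i\<in>{1..N}. if \<alpha> (par i) = \<alpha> i then 1/2 + 1/2 * \<rho> else 1/2 - 1/2 * \<rho>)"
  proof (intro prod.cong refl)
    fix i assume i: "i \<in> {1..N}"
    then have "\<alpha> i = -1 \<or> \<alpha> i = 1" "\<alpha> (par i) = -1 \<or> \<alpha> (par i) = 1"
      using \<alpha>[of i] \<alpha>[of "par i"] par[OF i] by auto
    then show "(1 + \<rho> * of_int (\<alpha> (par i)) * of_int (\<alpha> i)) / 2 =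
        (if \<alpha> (par i) = \<alpha> i then 1/2 + 1/2 * \<rho> else 1/2 - 1/2 * \<rho>)"
      by (auto simp: field_simps)
  qed
  also have "\<dots> = (1/2 + 1/2 * \<rho>) ^ card ?A * (1/2 - 1/2 * \<rho>) ^ card ?D"
    unfolding A_eq D_eq by (subst prod.If_cases) simp_all
  finally show ?thesis unfolding label_prob_def agree disagree by simp
qed

section \<open>Agreement probabilities as finite sums\<close>

text \<open>
  The outcome space is finite, so the product measure is determined by its values on singletons,
  which are boxes.
\<close>

lemma measure_strings:
  assumes fin: "finite (verts T)" and nonneg: "\<And>\<alpha>. 0 \<le> label_prob T \<rho> \<alpha>"
    and A: "A \<subseteq> {..<n} \<rightarrow>\<^sub>E (verts T \<rightarrow>\<^sub>E {-1, 1})"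
  shows "measure (strings_measure T \<rho> n) A = (\<Sum>\<omega>\<in>A. \<Prod>i<n. label_prob T \<rho> (\<omega> i))"
proof -
  let ?L = "verts T \<rightarrow>\<^sub>E {-1, 1::int}"
  let ?M = "strings_measure T \<rho> n"
  have finL: "finite ?L" using fin by (intro finite_PiE) auto
  have finA: "finite A" using A finL by (meson finite_PiE finite_lessThan finite_subset)
  have emeasure_label: "emeasure (label_measure T \<rho>) B = ennreal (\<Sum>\<alpha>\<in>B. label_prob T \<rho> \<alpha>)"
    if "B \<subseteq> ?L" for B
    unfolding label_measure_def using that finL nonneg
    by (subst emeasure_point_measure_finite) auto
  have sets_label: "sets (label_measure T \<rho>) = Pow ?L" and space_label: "space (label_measure T \<rho>) = ?L"
    by (simp_all add: label_measure_def sets_point_measure space_point_measure)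
  interpret L: finite_measure "label_measure T \<rho>"
    by standard (simp add: space_label emeasure_label)
  interpret product_sigma_finite "\<lambda>_::nat. label_measure T \<rho>" ..
  have single: "{\<omega>} \<in> sets ?M \<and> emeasure ?M {\<omega>} = ennreal (\<Prod>i<n. label_prob T \<rho> (\<omega> i))" if "\<omega> \<in> A" for \<omega>
  proof -
    have \<omega>: "\<omega> \<in> {..<n} \<rightarrow>\<^sub>E ?L" using A that by auto
    then have eq: "{\<omega>} = (\<Pi>\<^sub>E i\<in>{..<n}. {\<omega> i})" by (auto simp: PiE_singleton PiE_iff)
    have in_sets: "{\<omega> i} \<in> sets (label_measure T \<rho>)" if "i < n" for i
      using \<omega> that by (auto simp: sets_label)
    have "emeasure ?M {\<omega>} = (\<Prod>i<n. emeasure (label_measure T \<rho>) {\<omega> i})"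
      unfolding strings_measure_def by (subst eq, subst emeasure_PiM) (auto simp: in_sets)
    also have "\<dots> = (\<Prod>i<n. ennreal (label_prob T \<rho> (\<omega> i)))"
    proof (intro prod.cong refl)
      fix i assume "i \<in> {..<n}"
      then have "\<omega> i \<in> ?L" using \<omega> by (rule PiE_mem[rotated])
      then show "emeasure (label_measure T \<rho>) {\<omega> i} = ennreal (label_prob T \<rho> (\<omega> i))"
        using emeasure_label[of "{\<omega> i}"] by simp
    qed
    also have "\<dots> = ennreal (\<Prod>i<n. label_prob T \<rho> (\<omega> i))"
      using nonneg by (intro prod_ennreal) auto
    finally have "emeasure ?M {\<omega>} = ennreal (\<Prod>i<n. label_prob T \<rho> (\<omega> i))" .
    moreover have "{\<omega>} \<in> sets ?M"
      unfolding strings_measure_def by (subst eq) (auto intro!: sets_PiM_I_finite in_sets)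
    ultimately show ?thesis by simp
  qed
  have "measure ?M A = (\<Sum>\<omega>\<in>A. measure ?M {\<omega>})"
  proof (rule measure_eq_sum_singleton)
    show "finite A" by (rule finA)
  qed (use single in auto)
  also have "\<dots> = (\<Sum>\<omega>\<in>A. \<Prod>i<n. label_prob T \<rho> (\<omega> i))"
    using single nonneg by (intro sum.cong refl) (simp add: measure_def prod_nonneg)
  finally show ?thesis .
qed

text \<open>
  The sum over all assignments of strings to the vertices, with a factor \<open>a v\<close> at each vertex and a
  noise kernel along each edge. With indicators as factors it is \<open>2 ^ n\<close> times the probability that
  every string lies in the set prescribed at its vertex.
\<close>

definition tree_sum ::
    "nat \<Rightarrow> real \<Rightarrow> (nat \<Rightarrow> nat) \<Rightarrow> nat \<Rightarrow> (nat \<Rightarrow> (nat \<Rightarrow> int) \<Rightarrow> real) \<Rightarrow> real" where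
  "tree_sum n \<rho> par N a =
     (\<Sum>X\<in>{0..N} \<rightarrow>\<^sub>E cube n. (\<Prod>v\<in>{0..N}. a v (X v)) *
        (\<Prod>i\<in>{1..N}. noise_kernel n \<rho> (X (par i)) (X i)))"

lemma label_prob_nonneg: "0 \<le> \<rho> \<Longrightarrow> \<rho> \<le> 1 \<Longrightarrow> 0 \<le> label_prob T \<rho> \<alpha>"
  by (simp add: label_prob_def)

text \<open>
  An outcome is the same thing as an assignment of strings to the vertices, by exchanging the order
  of coordinates and vertices. After this exchange the product over the coordinates of the edge
  weights is the noise kernel along the edge, and the event splits according to the common bit
  \<open>s\<close>; the factors \<open>1/2\<close>, one for each coordinate, give \<open>1 / 2 ^ n\<close>.
\<close>

lemma agreement_prob_parent_tree:
  assumes par: "\<And>i. i \<in> {1..N} \<Longrightarrow> par i < i"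
    and \<rho>: "0 \<le> \<rho>" "\<rho> \<le> 1"
    and f: "\<And>v x. v \<in> {0..N} \<Longrightarrow> x \<in> cube n \<Longrightarrow> f v x = -1 \<or> f v x = 1"
  shows "agreement_prob (parent_tree par N) \<rho> n {0..N} f =
    (\<Sum>s\<in>{1, -1}. tree_sum n \<rho> par N (\<lambda>v x. of_bool (f v x = s))) / 2 ^ n"
proof -
  let ?T = "parent_tree par N" and ?V = "{0..N}"
  let ?\<Omega> = "{..<n} \<rightarrow>\<^sub>E (?V \<rightarrow>\<^sub>E {-1, 1::int})"
  let ?agree = "\<lambda>\<omega>. \<forall>u\<in>?V. \<forall>v\<in>?V. f u (string_at n \<omega> u) = f v (string_at n \<omega> v)"
  have verts: "verts ?T = ?V" by (simp add: parent_tree_def)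
  have space: "space (strings_measure ?T \<rho> n) = ?\<Omega>"
    by (simp add: strings_measure_def space_PiM label_measure_def space_point_measure verts)
  have fin: "finite ?\<Omega>" by (intro finite_PiE) auto
  have "agreement_prob ?T \<rho> n ?V f = (\<Sum>\<omega>\<in>{\<omega>\<in>?\<Omega>. ?agree \<omega>}. \<Prod>i<n. label_prob ?T \<rho> (\<omega> i))"
    unfolding agreement_prob_def space
    by (rule measure_strings) (auto simp: verts label_prob_nonneg \<rho>)
  also have "\<dots> = (\<Sum>\<omega>\<in>?\<Omega>. if ?agree \<omega> then \<Prod>i<n. label_prob ?T \<rho> (\<omega> i) else 0)"
    using fin by (rule sum.inter_filter)
  also have "\<dots> = (\<Sum>X\<in>?V \<rightarrow>\<^sub>E cube n.
      (\<Sum>s\<in>{1, -1}. \<Prod>v\<in>?V. of_bool (f v (X v) = s)) *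
      (\<Prod>i\<in>{1..N}. noise_kernel n \<rho> (X (par i)) (X i)) / 2 ^ n)"
  proof (rule sum.reindex_bij_witness[where i = "\<lambda>X. \<lambda>i\<in>{..<n}. \<lambda>v\<in>?V. X v i"
        and j = "\<lambda>\<omega>. \<lambda>v\<in>?V. string_at n \<omega> v"])
    fix \<omega> assume \<omega>: "\<omega> \<in> ?\<Omega>"
    define X where "X = (\<lambda>v\<in>?V. string_at n \<omega> v)"
    have val: "\<omega> i v = -1 \<or> \<omega> i v = 1" if "i < n" "v \<in> ?V" for i v
      using \<omega> that by (auto simp: PiE_iff)
    show "(\<lambda>i\<in>{..<n}. \<lambda>v\<in>?V. X v i) = \<omega>"
    proof (intro ext)
      fix i v
      show "(\<lambda>i\<in>{..<n}. \<lambda>v\<in>?V. X v i) i v = \<omega> i v"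
        using \<omega> by (cases "i < n"; cases "v \<in> ?V")
          (auto simp: X_def string_at_def PiE_iff extensional_def)
    qed
    have X: "X v \<in> cube n" if "v \<in> ?V" for v
      using that val by (auto simp: X_def string_at_def cube_def)
    then show "X \<in> ?V \<rightarrow>\<^sub>E cube n" by (auto simp: X_def)
    have "label_prob ?T \<rho> (\<omega> i) = 1/2 * (\<Prod>j\<in>{1..N}. (1 + \<rho> * of_int (X (par j) i) * of_int (X j i)) / 2)"
      if "i < n" for i
    proof -
      have "label_prob ?T \<rho> (\<omega> i) =
          1/2 * (\<Prod>j\<in>{1..N}. (1 + \<rho> * of_int (\<omega> i (par j)) * of_int (\<omega> i j)) / 2)"
        using par val[OF that] by (intro label_prob_parent_tree) auto
      also have "\<dots> = 1/2 * (\<Prod>j\<in>{1..N}. (1 + \<rho> * of_int (X (par j) i) * of_int (X j i)) / 2)"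
      proof (intro arg_cong2[where f = "(*)"] prod.cong refl)
        fix j assume j: "j \<in> {1..N}"
        then have "par j \<in> ?V" "j \<in> ?V" using par[OF j] by auto
        then show "(1 + \<rho> * of_int (\<omega> i (par j)) * of_int (\<omega> i j)) / 2 =
            (1 + \<rho> * of_int (X (par j) i) * of_int (X j i)) / 2"
          using that by (simp add: X_def string_at_def)
      qed
      finally show ?thesis .
    qed
    then have "(\<Prod>i<n. label_prob ?T \<rho> (\<omega> i)) =
        (\<Prod>i<n. 1/2 * (\<Prod>j\<in>{1..N}. (1 + \<rho> * of_int (X (par j) i) * of_int (X j i)) / 2))"
      by (intro prod.cong) auto
    also have "\<dots> = (1/2) ^ n * (\<Prod>i<n. \<Prod>j\<in>{1..N}. (1 + \<rho> * of_int (X (par j) i) * of_int (X j i)) / 2)"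
      by (simp only: prod.distrib prod_constant card_lessThan)
    also have "(\<Prod>i<n. \<Prod>j\<in>{1..N}. (1 + \<rho> * of_int (X (par j) i) * of_int (X j i)) / 2) =
        (\<Prod>j\<in>{1..N}. noise_kernel n \<rho> (X (par j)) (X j))"
      unfolding noise_kernel_def by (rule prod.swap)
    finally have weight: "(\<Prod>i<n. label_prob ?T \<rho> (\<omega> i)) =
        (\<Prod>j\<in>{1..N}. noise_kernel n \<rho> (X (par j)) (X j)) / 2 ^ n"
      by (simp add: power_one_over)
    have agree: "?agree \<omega> \<longleftrightarrow> (\<forall>u\<in>?V. \<forall>v\<in>?V. f u (X u) = f v (X v))"
      by (simp add: X_def)
    have "(if ?agree \<omega> then 1 else 0 :: real) = (\<Sum>s\<in>{1, -1}. \<Prod>v\<in>?V. of_bool (f v (X v) = s))"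
    proof -
      have prod: "(\<Prod>v\<in>?V. of_bool (f v (X v) = s) :: real) = of_bool (\<forall>v\<in>?V. f v (X v) = s)" for s
      proof (cases "\<forall>v\<in>?V. f v (X v) = s")
        case False
        then obtain v where "v \<in> ?V" "f v (X v) \<noteq> s" by auto
        then have "(\<Prod>v\<in>?V. of_bool (f v (X v) = s) :: real) = 0"
          by (intro prod_zero) auto
        with False show ?thesis by (simp only: of_bool_def if_False)
      qed simp
      have root: "0 \<in> ?V" by simp
      consider "f 0 (X 0) = 1" | "f 0 (X 0) = -1" using f[OF root X[OF root]] by auto
      then show ?thesis
      proof cases
        case 1
        then have "?agree \<omega> \<longleftrightarrow> (\<forall>v\<in>?V. f v (X v) = 1)" "\<not> (\<forall>v\<in>?V. f v (X v) = -1)"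
          unfolding agree using root by (metis, force)
        then show ?thesis unfolding prod by (auto intro: exI[of _ 0])
      next
        case 2
        then have "?agree \<omega> \<longleftrightarrow> (\<forall>v\<in>?V. f v (X v) = -1)" "\<not> (\<forall>v\<in>?V. f v (X v) = 1)"
          unfolding agree using root by (metis, force)
        then show ?thesis unfolding prod by (auto intro: exI[of _ 0])
      qed
    qed
    then show "(\<Sum>s\<in>{1, -1}. \<Prod>v\<in>?V. of_bool (f v (X v) = s)) *
        (\<Prod>i\<in>{1..N}. noise_kernel n \<rho> (X (par i)) (X i)) / 2 ^ n =
        (if ?agree \<omega> then \<Prod>i<n. label_prob ?T \<rho> (\<omega> i) else 0)"
      unfolding weight by (metis (no_types, lifting) div_0 mult_1 mult_zero_left)
  next
    fix X assume X: "X \<in> ?V \<rightarrow>\<^sub>E cube n"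
    show "(\<lambda>i\<in>{..<n}. \<lambda>v\<in>?V. X v i) \<in> ?\<Omega>"
      using X by (auto simp: cube_def PiE_iff)
    show "(\<lambda>v\<in>?V. string_at n (\<lambda>i\<in>{..<n}. \<lambda>v\<in>?V. X v i) v) = X"
    proof (intro ext)
      fix v i
      show "(\<lambda>v\<in>?V. string_at n (\<lambda>i\<in>{..<n}. \<lambda>v\<in>?V. X v i) v) v i = X v i"
        using X by (cases "i < n"; cases "v \<in> ?V")
          (auto simp: string_at_def cube_def PiE_iff extensional_def)
    qed
  qed
  also have "\<dots> = (\<Sum>s\<in>{1, -1}. tree_sum n \<rho> par N (\<lambda>v x. of_bool (f v x = s))) / 2 ^ n"
    unfolding tree_sum_def sum_divide_distrib sum_distrib_right by (rule sum.swap)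
  finally show ?thesis .
qed

lemma tree_sum_cong:
  assumes "\<And>v. v \<in> {0..N} \<Longrightarrow> a v = b v"
  shows "tree_sum n \<rho> par N a = tree_sum n \<rho> par N b"
  unfolding tree_sum_def using assms by (intro sum.cong refl arg_cong2[where f = "(*)"] prod.cong) auto

text \<open>
  The largest vertex is a leaf; summing out its string applies the noise operator to its factor, and the result
  is absorbed into the factor of its parent.
\<close>

lemma tree_sum_peel:
  assumes par: "\<And>i. i \<in> {1..Suc N} \<Longrightarrow> par i < i"
  defines "q \<equiv> par (Suc N)"
  shows "tree_sum n \<rho> par (Suc N) a =
    tree_sum n \<rho> par N (a(q := \<lambda>x. a q x * noise n \<rho> (a (Suc N)) x))"
proof -
  let ?g = "\<lambda>X y. noise_kernel n \<rho> (X q) y * a (Suc N) y"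
  let ?h = "\<lambda>X. (\<Prod>v\<in>{0..N}. a v (X v)) * (\<Prod>i\<in>{1..N}. noise_kernel n \<rho> (X (par i)) (X i))"
  let ?a = "a(q := \<lambda>x. a q x * noise n \<rho> (a (Suc N)) x)"
  have q: "q \<in> {0..N}" using par[of "Suc N"] by (auto simp: q_def)
  have "tree_sum n \<rho> par (Suc N) a =
      (\<Sum>(y, X)\<in>cube n \<times> ({0..N} \<rightarrow>\<^sub>E cube n). ?h X * ?g X y)"
    unfolding tree_sum_def
  proof (rule sum.reindex_bij_witness[where i = "\<lambda>(y, X). X(Suc N := y)"
        and j = "\<lambda>X. (X (Suc N), restrict X {0..N})"])
    fix X assume X: "X \<in> {0..Suc N} \<rightarrow>\<^sub>E cube n"
    let ?X = "restrict X {0..N}"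
    show "(case (X (Suc N), ?X) of (y, X) \<Rightarrow> X(Suc N := y)) = X"
      using X by (auto simp: fun_eq_iff PiE_iff extensional_def)
    show "(X (Suc N), ?X) \<in> cube n \<times> ({0..N} \<rightarrow>\<^sub>E cube n)"
      using X by (auto simp: PiE_iff)
    have "(\<Prod>v\<in>{0..N}. a v (?X v)) = (\<Prod>v\<in>{0..N}. a v (X v))"
      by (intro prod.cong) auto
    moreover have "(\<Prod>i\<in>{1..N}. noise_kernel n \<rho> (?X (par i)) (?X i)) =
        (\<Prod>i\<in>{1..N}. noise_kernel n \<rho> (X (par i)) (X i))"
    proof (intro prod.cong refl)
      fix i assume i: "i \<in> {1..N}"
      then have "par i \<in> {0..N}" using par[of i] by auto
      then show "noise_kernel n \<rho> (?X (par i)) (?X i) = noise_kernel n \<rho> (X (par i)) (X i)"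
        using i by simp
    qed
    moreover have "?X q = X q" using q by simp
    ultimately show "(case (X (Suc N), ?X) of (y, X) \<Rightarrow> ?h X * ?g X y) =
        (\<Prod>v\<in>{0..Suc N}. a v (X v)) * (\<Prod>i\<in>{1..Suc N}. noise_kernel n \<rho> (X (par i)) (X i))"
      by (simp add: q_def del: restrict_apply)
  next
    fix Xy assume "Xy \<in> cube n \<times> ({0..N} \<rightarrow>\<^sub>E cube n)"
    then obtain y X where *: "Xy = (y, X)" "y \<in> cube n" "X \<in> {0..N} \<rightarrow>\<^sub>E cube n" by auto
    then show "(case Xy of (y, X) \<Rightarrow> X(Suc N := y)) \<in> {0..Suc N} \<rightarrow>\<^sub>E cube n"
      by (auto simp: PiE_iff extensional_def)
    have "X i = undefined" if "i \<notin> {0..N}" for i using * that by (auto simp: PiE_iff extensional_def)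
    with * show "((case Xy of (y, X) \<Rightarrow> X(Suc N := y)) (Suc N),
        restrict (case Xy of (y, X) \<Rightarrow> X(Suc N := y)) {0..N}) = Xy"
      by (auto simp: fun_eq_iff)
  qed
  also have "\<dots> = (\<Sum>y\<in>cube n. \<Sum>X\<in>{0..N} \<rightarrow>\<^sub>E cube n. ?h X * ?g X y)"
    by (rule sum.cartesian_product[symmetric])
  also have "\<dots> = (\<Sum>X\<in>{0..N} \<rightarrow>\<^sub>E cube n. \<Sum>y\<in>cube n. ?h X * ?g X y)"
    by (rule sum.swap)
  also have "\<dots> = (\<Sum>X\<in>{0..N} \<rightarrow>\<^sub>E cube n. ?h X * noise n \<rho> (a (Suc N)) (X q))"
    by (simp only: noise_def sum_distrib_left)
  also have "\<dots> = tree_sum n \<rho> par N ?a"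
    unfolding tree_sum_def
  proof (intro sum.cong refl)
    fix X :: "nat \<Rightarrow> nat \<Rightarrow> int"
    have "(\<Prod>v\<in>{0..N}. ?a v (X v)) = (\<Prod>v\<in>{0..N}. a v (X v) * (if v = q then noise n \<rho> (a (Suc N)) (X q) else 1))"
      by (intro prod.cong) auto
    also have "\<dots> = (\<Prod>v\<in>{0..N}. a v (X v)) * noise n \<rho> (a (Suc N)) (X q)"
      using q by (simp add: prod.distrib)
    finally show "?h X * noise n \<rho> (a (Suc N)) (X q) =
        (\<Prod>v\<in>{0..N}. ?a v (X v)) * (\<Prod>i\<in>{1..N}. noise_kernel n \<rho> (X (par i)) (X i))"
      by simp
  qed
  finally show ?thesis .
qed

lemma tree_sum_root: "tree_sum n \<rho> par 0 a = (\<Sum>x\<in>cube n. a 0 x)"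
  unfolding tree_sum_def
  by (rule sum.reindex_bij_witness[where i = "\<lambda>x. \<lambda>v\<in>{0}. x" and j = "\<lambda>X. X 0"])
    (auto simp: fun_eq_iff PiE_iff extensional_def)

section \<open>The star with a path\<close>

text \<open>
  The parents for the given numbering: the leaves \<open>1, \<dots>, k\<^sub>1\<close> and the first path vertex
  \<open>k\<^sub>1 + 1\<close> hang at the center, every later path vertex at its predecessor.
\<close>

definition star_path_parent :: "nat \<Rightarrow> nat \<Rightarrow> nat" where
  "star_path_parent k\<^sub>1 i = (if i \<le> Suc k\<^sub>1 then 0 else i - 1)"

lemma star_path_parent_less: "i \<in> {1..N} \<Longrightarrow> star_path_parent k\<^sub>1 i < i"
  by (auto simp: star_path_parent_def)

lemma star_with_path_eq: "star_with_path k\<^sub>1 k\<^sub>2 = parent_tree (star_path_parent k\<^sub>1) (k\<^sub>1 + k\<^sub>2)"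
proof -
  let ?e = "\<lambda>i. {star_path_parent k\<^sub>1 i, i}"
  have "{1..k\<^sub>1 + k\<^sub>2} = {1..k\<^sub>1} \<union> (\<lambda>j. k\<^sub>1 + Suc j) ` {..<k\<^sub>2}"
  proof (intro equalityI subsetI)
    fix i assume "i \<in> {1..k\<^sub>1 + k\<^sub>2}"
    then show "i \<in> {1..k\<^sub>1} \<union> (\<lambda>j. k\<^sub>1 + Suc j) ` {..<k\<^sub>2}"
      by (cases "i \<le> k\<^sub>1") (auto intro!: image_eqI[where x = "i - Suc k\<^sub>1"])
  qed auto
  then have "?e ` {1..k\<^sub>1 + k\<^sub>2} = ?e ` {1..k\<^sub>1} \<union> (\<lambda>j. ?e (k\<^sub>1 + Suc j)) ` {..<k\<^sub>2}"
    by (simp only: image_Un image_image)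
  also have "?e ` {1..k\<^sub>1} = (\<lambda>i. {0, i}) ` {1..k\<^sub>1}"
    by (intro image_cong) (auto simp: star_path_parent_def)
  also have "(\<lambda>j. ?e (k\<^sub>1 + Suc j)) = (\<lambda>j. {path_vertex k\<^sub>1 j, path_vertex k\<^sub>1 (Suc j)})"
    by (auto simp: star_path_parent_def path_vertex_def fun_eq_iff)
  finally show ?thesis unfolding star_with_path_def parent_tree_def by simp
qed

lemma verts_star_with_path: "verts (star_with_path k\<^sub>1 k\<^sub>2) = {0..k\<^sub>1 + k\<^sub>2}"
  by (simp add: star_with_path_def)

lemma tree_sum_star:
  assumes "m \<le> k\<^sub>1"
  shows "tree_sum n \<rho> (star_path_parent k\<^sub>1) m (\<lambda>v. if v = 0 then h else u) =
    (\<Sum>x\<in>cube n. h x * noise n \<rho> u x ^ m)"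
  using assms
proof (induction m arbitrary: h)
  case 0
  then show ?case by (simp add: tree_sum_root)
next
  case (Suc m)
  have root: "star_path_parent k\<^sub>1 (Suc m) = 0" using Suc.prems by (simp add: star_path_parent_def)
  have "tree_sum n \<rho> (star_path_parent k\<^sub>1) (Suc m) (\<lambda>v. if v = 0 then h else u) =
      tree_sum n \<rho> (star_path_parent k\<^sub>1) m (\<lambda>v. if v = 0 then (\<lambda>x. h x * noise n \<rho> u x) else u)"
    by (subst tree_sum_peel[OF star_path_parent_less]) (auto simp: root intro!: tree_sum_cong)
  also have "\<dots> = (\<Sum>x\<in>cube n. h x * noise n \<rho> u x * noise n \<rho> u x ^ m)"
    using Suc.prems by (intro Suc.IH) simp
  finally show ?case by (simp add: mult.assoc)
qed

text \<open>
  The path is summed out from its end. To make this an induction, the last path vertex carries the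
  survival probability already collected from \<open>k\<close> removed vertices.
\<close>

lemma tree_sum_star_with_path:
  "tree_sum n \<rho> (star_path_parent k\<^sub>1) (k\<^sub>1 + k\<^sub>2)
      (\<lambda>v. if v \<in> {1..k\<^sub>1} then u else if v = path_vertex k\<^sub>1 k\<^sub>2 then survival n \<rho> w k else w) =
    (\<Sum>x\<in>cube n. survival n \<rho> w (k + k\<^sub>2) x * noise n \<rho> u x ^ k\<^sub>1)"
proof (induction k\<^sub>2 arbitrary: k)
  case 0
  have "tree_sum n \<rho> (star_path_parent k\<^sub>1) (k\<^sub>1 + 0)
      (\<lambda>v. if v \<in> {1..k\<^sub>1} then u else if v = path_vertex k\<^sub>1 0 then survival n \<rho> w k else w) =
    tree_sum n \<rho> (star_path_parent k\<^sub>1) k\<^sub>1 (\<lambda>v. if v = 0 then survival n \<rho> w k else u)"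
    unfolding add_0_right by (intro tree_sum_cong) (auto simp: path_vertex_def)
  then show ?case by (simp add: tree_sum_star)
next
  case (Suc k\<^sub>2)
  let ?a = "\<lambda>j k v. if v \<in> {1..k\<^sub>1} then u else if v = path_vertex k\<^sub>1 j then survival n \<rho> w k else w"
  let ?q = "star_path_parent k\<^sub>1 (Suc (k\<^sub>1 + k\<^sub>2))"
  have q: "?q = path_vertex k\<^sub>1 k\<^sub>2" by (auto simp: star_path_parent_def path_vertex_def)
  have last: "?a (Suc k\<^sub>2) k (Suc (k\<^sub>1 + k\<^sub>2)) = survival n \<rho> w k" by (auto simp: path_vertex_def)
  have "tree_sum n \<rho> (star_path_parent k\<^sub>1) (Suc (k\<^sub>1 + k\<^sub>2)) (?a (Suc k\<^sub>2) k) =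
      tree_sum n \<rho> (star_path_parent k\<^sub>1) (k\<^sub>1 + k\<^sub>2) ((?a (Suc k\<^sub>2) k)
        (?q := \<lambda>x. ?a (Suc k\<^sub>2) k ?q x * noise n \<rho> (?a (Suc k\<^sub>2) k (Suc (k\<^sub>1 + k\<^sub>2))) x))"
    by (rule tree_sum_peel[OF star_path_parent_less])
  also have "\<dots> = tree_sum n \<rho> (star_path_parent k\<^sub>1) (k\<^sub>1 + k\<^sub>2) (?a k\<^sub>2 (Suc k))"
    unfolding last q by (intro tree_sum_cong) (auto simp: path_vertex_def fun_eq_iff)
  also have "\<dots> = (\<Sum>x\<in>cube n. survival n \<rho> w (Suc k + k\<^sub>2) x * noise n \<rho> u x ^ k\<^sub>1)"
    by (rule Suc.IH)
  finally show ?case by (simp only: add_Suc_right add_Suc)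
qed

text \<open>
  Given the string \<open>x\<close> of the center, the leaves are independent of each other and of the path.
\<close>

lemma agreement_prob_star_with_path:
  assumes \<rho>: "0 \<le> \<rho>" "\<rho> \<le> 1"
    and u: "\<And>x. x \<in> cube n \<Longrightarrow> u x = -1 \<or> u x = 1"
    and w: "\<And>x. x \<in> cube n \<Longrightarrow> w x = -1 \<or> w x = 1"
    and f: "\<And>v. v \<in> {0..k\<^sub>1 + k\<^sub>2} \<Longrightarrow> f v = (if v \<in> {1..k\<^sub>1} then u else w)"
  shows "agreement_prob (star_with_path k\<^sub>1 k\<^sub>2) \<rho> n (verts (star_with_path k\<^sub>1 k\<^sub>2)) f =
    (\<Sum>s\<in>{1, -1}. mean n (\<lambda>x. survival n \<rho> (\<lambda>x. of_bool (w x = s)) k\<^sub>2 x *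
       noise n \<rho> (\<lambda>x. of_bool (u x = s)) x ^ k\<^sub>1))"
proof -
  have "tree_sum n \<rho> (star_path_parent k\<^sub>1) (k\<^sub>1 + k\<^sub>2) (\<lambda>v x. of_bool (f v x = s)) =
    (\<Sum>x\<in>cube n. survival n \<rho> (\<lambda>x. of_bool (w x = s)) (0 + k\<^sub>2) x * noise n \<rho> (\<lambda>x. of_bool (u x = s)) x ^ k\<^sub>1)" for s
    unfolding tree_sum_star_with_path[symmetric]
    by (intro tree_sum_cong) (auto simp: f survival_zero)
  then have "tree_sum n \<rho> (star_path_parent k\<^sub>1) (k\<^sub>1 + k\<^sub>2) (\<lambda>v x. of_bool (f v x = s)) / 2 ^ n =
    mean n (\<lambda>x. survival n \<rho> (\<lambda>x. of_bool (w x = s)) k\<^sub>2 x *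
       noise n \<rho> (\<lambda>x. of_bool (u x = s)) x ^ k\<^sub>1)" for s
    by (simp only: mean_def add_0)
  then show ?thesis
    unfolding star_with_path_eq verts_star_with_path[unfolded star_with_path_eq]
    using u w f \<rho> by (subst agreement_prob_parent_tree) (auto simp: star_path_parent_less sum_divide_distrib add_divide_distrib)
qed

section \<open>Balanced functions\<close>

lemma balanced_values: "balanced n f \<Longrightarrow> x \<in> cube n \<Longrightarrow> f x = -1 \<or> f x = 1"
  by (auto simp: balanced_def PiE_iff)

lemma finite_balanced: "finite {f. balanced n f}"
proof (rule finite_subset)
  show "{f. balanced n f} \<subseteq> cube n \<rightarrow>\<^sub>E {-1, 1}" by (auto simp: balanced_def)
qed (intro finite_PiE; simp)

lemma mean_of_bool: "mean n (\<lambda>x. of_bool (P x)) = real (card {x \<in> cube n. P x}) / 2 ^ n"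
  by (simp add: mean_def of_bool_def sum.If_cases Int_def)

lemma mean_balanced:
  assumes "balanced n f" "1 \<le> n" "s \<in> {1, -1}"
  shows "mean n (\<lambda>x. of_bool (f x = s)) = 1/2"
proof -
  have "2 ^ n = 2 * (2 ^ (n - 1) :: real)" using assms(2) by (cases n) auto
  then show ?thesis using assms by (auto simp: mean_of_bool balanced_def)
qed

lemma balanced_if_odd:
  assumes n: "1 \<le> n" and f: "f \<in> cube n \<rightarrow>\<^sub>E {-1, 1}"
    and odd: "\<And>x. x \<in> cube n \<Longrightarrow> f (\<lambda>i\<in>{..<n}. - x i) = - f x"
  shows "balanced n f"
proof -
  let ?P = "{x \<in> cube n. f x = 1}" and ?N = "{x \<in> cube n. f x = -1}"
  let ?neg = "\<lambda>x. \<lambda>i\<in>{..<n}. - x i :: int"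
  have neg: "?neg x \<in> cube n" if "x \<in> cube n" for x using that by (auto simp: cube_def PiE_iff)
  have neg_neg: "?neg (?neg x) = x" if "x \<in> cube n" for x
    using that by (auto simp: cube_def PiE_iff extensional_def fun_eq_iff)
  have "bij_betw ?neg ?P ?N"
    by (rule bij_betw_byWitness[where f' = ?neg]) (auto simp: neg neg_neg odd simp del: restrict_apply)
  then have eq: "card ?P = card ?N" by (rule bij_betw_same_card)
  have "cube n = ?P \<union> ?N" using f by (auto simp: PiE_iff)
  then have "card (cube n) = card (?P \<union> ?N)" by simp
  also have "\<dots> = card ?P + card ?N" by (intro card_Un_disjoint) auto
  finally have "2 ^ n = 2 * card ?N" by (simp add: card_cube eq)
  moreover have "2 ^ n = 2 * (2 ^ (n - 1) :: nat)" using n by (cases n) auto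
  ultimately show ?thesis using f eq by (simp add: balanced_def)
qed

definition dictator :: "nat \<Rightarrow> (nat \<Rightarrow> int) \<Rightarrow> int" where
  "dictator n = (\<lambda>x\<in>cube n. x 0)"

definition majority3 :: "nat \<Rightarrow> (nat \<Rightarrow> int) \<Rightarrow> int" where
  "majority3 n = (\<lambda>x\<in>cube n. if 0 < x 0 + x 1 + x 2 then 1 else -1)"

lemma balanced_dictator: "1 \<le> n \<Longrightarrow> balanced n (dictator n)"
  by (rule balanced_if_odd) (auto simp: dictator_def cube_def PiE_iff)

lemma balanced_majority3:
  assumes "3 \<le> n"
  shows "balanced n (majority3 n)"
proof (rule balanced_if_odd)
  fix x assume x: "x \<in> cube n"
  have "(\<lambda>i\<in>{..<n}. - x i) \<in> cube n" using x by (auto simp: cube_def PiE_iff)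
  moreover have "x 0 = -1 \<or> x 0 = 1" "x 1 = -1 \<or> x 1 = 1" "x 2 = -1 \<or> x 2 = 1"
    using cube_cases[OF x] assms by auto
  ultimately show "majority3 n (\<lambda>i\<in>{..<n}. - x i) = - majority3 n x"
    using x assms by (auto simp: majority3_def)
qed (use assms in \<open>auto simp: majority3_def\<close>)

text \<open>
  A dictator has the constant survival probability \<open>(1 + \<rho>) / 2\<close>, the extremal case of the
  dichotomy for density \<open>1/2\<close>.
\<close>

lemma noise_dictator:
  assumes "1 \<le> n" "x \<in> cube n"
  defines "a \<equiv> \<lambda>x. of_bool (dictator n x = 1)"
  shows "a x * noise n \<rho> a x = (1 + \<rho>) / 2 * a x"
proof -
  have "noise n \<rho> a = noise n \<rho> (\<lambda>x. 1/2 * (1 + walsh {0} x))"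
  proof (rule noise_cong)
    fix y assume "y \<in> cube n"
    then show "a y = 1/2 * (1 + walsh {0} y)"
      using cube_cases[of y n 0] assms(1) by (auto simp: a_def dictator_def walsh_def)
  qed
  then have "noise n \<rho> a x = 1/2 * (1 + noise n \<rho> (walsh {0}) x)"
    by (simp only: noise_linear noise_one)
  also have "noise n \<rho> (walsh {0}) x = \<rho> * of_int (x 0)"
    using assms(1) by (subst noise_walsh) (auto simp: walsh_def)
  finally have "noise n \<rho> a x = 1/2 * (1 + \<rho> * of_int (x 0))" .
  then show ?thesis using assms(2) by (auto simp: a_def dictator_def)
qed

text \<open>
  One noisy step from the string of ones keeps the majority of three with a larger probability than
  \<open>(1 + \<rho>) / 2\<close>, the value for a dictator, if \<open>0 < \<rho> < 1\<close>, because then \<open>\<rho> ^ 3 < \<rho>\<close>. The value is read off the Fourier expansion of the majority.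
\<close>

lemma noise_majority3:
  assumes n: "3 \<le> n"
  shows "noise n \<rho> (\<lambda>x. of_bool (majority3 n x = 1)) (\<lambda>i\<in>{..<n}. 1) = 1/2 + (3 * \<rho> - \<rho> ^ 3) / 4"
proof -
  let ?x = "\<lambda>i\<in>{..<n}. 1::int"
  have "noise n \<rho> (\<lambda>x. of_bool (majority3 n x = 1)) =
      noise n \<rho> (\<lambda>x. 1/2 * 1 + 1/4 * (walsh {0} x + walsh {1} x + walsh {2} x - walsh {0, 1, 2} x))"
  proof (rule noise_cong)
    fix y assume y: "y \<in> cube n"
    then have "y 0 = -1 \<or> y 0 = 1" "y 1 = -1 \<or> y 1 = 1" "y 2 = -1 \<or> y 2 = 1"
      using cube_cases[OF y] n by auto
    then show "of_bool (majority3 n y = 1) =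
        1/2 * 1 + 1/4 * (walsh {0} y + walsh {1} y + walsh {2} y - walsh {0, 1, 2} y)"
      using y by (auto simp: majority3_def walsh_def)
  qed
  then have "noise n \<rho> (\<lambda>x. of_bool (majority3 n x = 1)) ?x = 1/2 * 1 + 1/4 *
      (noise n \<rho> (walsh {0}) ?x + noise n \<rho> (walsh {1}) ?x + noise n \<rho> (walsh {2}) ?x - noise n \<rho> (walsh {0, 1, 2}) ?x)"
    by (simp only: noise_linear noise_one)
  moreover have "noise n \<rho> (walsh U) ?x = \<rho> ^ card U" if "U \<subseteq> {0, 1, 2}" for U
  proof -
    have U: "U \<subseteq> {..<n}" using that n by auto
    then have "walsh U ?x = 1" unfolding walsh_def by (intro prod.neutral) auto
    with U show ?thesis by (simp add: noise_walsh)
  qed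
  ultimately show ?thesis by (simp add: numeral_3_eq_3 field_simps)
qed

section \<open>Comparison of simple and non-simple protocols\<close>

text \<open>
  For a star with \<open>m\<close> leaves and a long path, using one set everywhere: if the one-step survival
  probability is constant on the set, equality holds; otherwise the path alone makes the left-hand
  side of smaller order than the right-hand side as \<open>k\<close> grows, whatever the star gains.
\<close>

lemma eventually_confined_le:
  assumes \<rho>: "0 < \<rho>" "\<rho> < 1"
    and a: "\<And>x. x \<in> cube n \<Longrightarrow> a x = 0 \<or> a x = 1" and pos: "0 < mean n a"
  shows "eventually (\<lambda>k. mean n (\<lambda>x. survival n \<rho> a k x * noise n \<rho> a x ^ m)
    \<le> mean n a * (\<rho> + (1 - \<rho>) * mean n a) ^ (m + k)) sequentially"
proof -
  define \<kappa> where "\<kappa> = \<rho> + (1 - \<rho>) * mean n a"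
  have \<kappa>: "0 < \<kappa>" using \<rho> pos by (simp add: \<kappa>_def add_pos_nonneg)
  have a_nonneg: "0 \<le> a x" and a_le: "a x \<le> 1" if "x \<in> cube n" for x using a[OF that] by auto
  consider (const) "\<forall>x\<in>cube n. a x * noise n \<rho> a x = \<kappa> * a x"
    | (decay) "(\<lambda>k. mean n (survival n \<rho> a k) / \<kappa> ^ k) \<longlonglongrightarrow> 0"
    using survival_dichotomy[OF \<rho>, of n a] a unfolding \<kappa>_def by blast
  then show ?thesis
  proof cases
    case const
    have "mean n (\<lambda>x. survival n \<rho> a k x * noise n \<rho> a x ^ m) = mean n a * \<kappa> ^ (m + k)" for k
    proof -
      have "survival n \<rho> a k x * noise n \<rho> a x ^ m = \<kappa> ^ (m + k) * a x" if x: "x \<in> cube n" for x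
      proof -
        have "survival n \<rho> a k x = \<kappa> ^ k * a x" using const x by (intro survival_const) auto
        moreover have "a x = 1 \<Longrightarrow> noise n \<rho> a x = \<kappa>" using const x by auto
        ultimately show ?thesis using a[OF x] by (auto simp: power_add)
      qed
      then have "mean n (\<lambda>x. survival n \<rho> a k x * noise n \<rho> a x ^ m) = mean n (\<lambda>x. \<kappa> ^ (m + k) * a x)"
        by (rule mean_cong)
      then show ?thesis by (simp add: mean_cmult)
    qed
    then show ?thesis unfolding \<kappa>_def[symmetric] by simp
  next
    case decay
    have "eventually (\<lambda>k. mean n (survival n \<rho> a k) / \<kappa> ^ k < mean n a * \<kappa> ^ m) sequentially"
      using decay pos \<kappa> by (intro order_tendstoD(2)) auto
    then show ?thesis
    proof eventually_elim
      case (elim k)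
      have "mean n (\<lambda>x. survival n \<rho> a k x * noise n \<rho> a x ^ m) \<le> mean n (survival n \<rho> a k)"
      proof (rule mean_mono)
        fix x assume x: "x \<in> cube n"
        have "noise n \<rho> a x ^ m \<le> 1"
          using \<rho> x a_nonneg a_le by (intro power_le_one noise_nonneg noise_le_one) auto
        moreover have "0 \<le> survival n \<rho> a k x" using \<rho> x a_nonneg by (intro survival_nonneg) auto
        ultimately show "survival n \<rho> a k x * noise n \<rho> a x ^ m \<le> survival n \<rho> a k x"
          by (simp add: mult_left_le)
      qed
      also have "\<dots> \<le> mean n a * \<kappa> ^ (m + k)"
        using elim \<kappa> by (simp add: field_simps power_add)
      finally show ?case unfolding \<kappa>_def .
    qed
  qed
qed

text \<open>
  There are only finitely many balanced functions, so one path length serves all of them; each of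
  the two values of the common bit contributes at most half of the bound.
\<close>

lemma exists_path_length_simple_le:
  assumes \<rho>: "0 < \<rho>" "\<rho> < 1" and n: "1 \<le> n"
  shows "\<exists>k\<^sub>2. \<forall>h. balanced n h \<longrightarrow>
    (\<Sum>s\<in>{1, -1}. mean n (\<lambda>x. survival n \<rho> (\<lambda>x. of_bool (h x = s)) k\<^sub>2 x *
       noise n \<rho> (\<lambda>x. of_bool (h x = s)) x ^ k\<^sub>1)) \<le> ((1 + \<rho>) / 2) ^ (k\<^sub>1 + k\<^sub>2)"
proof -
  let ?m = "\<lambda>h s k. mean n (\<lambda>x. survival n \<rho> (\<lambda>x. of_bool (h x = s)) k x *
       noise n \<rho> (\<lambda>x. of_bool (h x = s)) x ^ k\<^sub>1)"
  have rate: "\<rho> + (1 - \<rho>) * (1/2) = (1 + \<rho>) / 2" by (simp add: field_simps)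
  have half: "eventually (\<lambda>k. ?m h s k \<le> 1/2 * ((1 + \<rho>) / 2) ^ (k\<^sub>1 + k)) sequentially"
    if "balanced n h" "s \<in> {1, -1}" for h s
    using eventually_confined_le[OF \<rho>, of n "\<lambda>x. of_bool (h x = s)" k\<^sub>1]
    unfolding mean_balanced[OF that(1) n that(2)] rate by simp
  have "eventually (\<lambda>k. \<forall>h\<in>{h. balanced n h}. (\<Sum>s\<in>{1, -1}. ?m h s k) \<le> ((1 + \<rho>) / 2) ^ (k\<^sub>1 + k)) sequentially"
  proof (intro eventually_ball_finite finite_balanced ballI)
    fix h assume "h \<in> {h. balanced n h}"
    then have h: "balanced n h" by simp
    from half[OF h, of 1] half[OF h, of "-1"]
    have "eventually (\<lambda>k. ?m h 1 k \<le> 1/2 * ((1 + \<rho>) / 2) ^ (k\<^sub>1 + k) \<and>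
        ?m h (-1) k \<le> 1/2 * ((1 + \<rho>) / 2) ^ (k\<^sub>1 + k)) sequentially"
      by (intro eventually_conj) simp_all
    then show "eventually (\<lambda>k. (\<Sum>s\<in>{1, -1}. ?m h s k) \<le> ((1 + \<rho>) / 2) ^ (k\<^sub>1 + k)) sequentially"
      by eventually_elim simp
  qed
  then obtain k where "\<forall>h\<in>{h. balanced n h}. (\<Sum>s\<in>{1, -1}. ?m h s k) \<le> ((1 + \<rho>) / 2) ^ (k\<^sub>1 + k)"
    by (auto simp only: eventually_sequentially)
  then show ?thesis by (intro exI[of _ k]) simp
qed

text \<open>
  The leaves use the majority of three and the other vertices a dictator. With many leaves the
  single string of ones at the center, although of weight \<open>1 / 2 ^ n\<close>, already contributes enough,
  while each edge of the path costs a factor \<open>(1 + \<rho>) / 2\<close> on both sides of the inequality. The number of leaves can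
  therefore be chosen before the length of the path.
\<close>

lemma exists_star_size_mixed_gt:
  assumes \<rho>: "0 < \<rho>" "\<rho> < 1" and n: "3 \<le> n"
  shows "\<exists>k\<^sub>1. \<forall>k\<^sub>2. ((1 + \<rho>) / 2) ^ (k\<^sub>1 + k\<^sub>2) <
    (\<Sum>s\<in>{1, -1}. mean n (\<lambda>x. survival n \<rho> (\<lambda>x. of_bool (dictator n x = s)) k\<^sub>2 x *
       noise n \<rho> (\<lambda>x. of_bool (majority3 n x = s)) x ^ k\<^sub>1))"
proof -
  define p where "p = (1 + \<rho>) / 2"
  define q where "q = 1/2 + (3 * \<rho> - \<rho> ^ 3) / 4"
  have p: "0 < p" using \<rho> by (simp add: p_def)
  have "\<rho> ^ 3 < \<rho>" using power_strict_decreasing[of 1 3 \<rho>] \<rho> by simp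
  then have pq: "p < q" by (simp add: p_def q_def field_simps)
  then have "1 < q / p" using p by simp
  then obtain k\<^sub>1 where "2 ^ n < (q / p) ^ k\<^sub>1" using real_arch_pow by blast
  then have k\<^sub>1: "2 ^ n * p ^ k\<^sub>1 < q ^ k\<^sub>1" using p by (simp add: power_divide field_simps)
  let ?t = "\<lambda>k s x. survival n \<rho> (\<lambda>x. of_bool (dictator n x = s)) k x *
       noise n \<rho> (\<lambda>x. of_bool (majority3 n x = s)) x ^ k\<^sub>1"
  define e where "e = (\<lambda>i\<in>{..<n}. 1::int)"
  have e: "e \<in> cube n" by (auto simp: e_def cube_def)
  have nonneg: "0 \<le> ?t k s x" if "x \<in> cube n" for k s x
    using \<rho> that by (intro mult_nonneg_nonneg zero_le_power survival_nonneg noise_nonneg) auto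
  have "p ^ (k\<^sub>1 + k) < (\<Sum>s\<in>{1, -1}. mean n (?t k s))" for k
  proof -
    have "survival n \<rho> (\<lambda>x. of_bool (dictator n x = 1)) k e = p ^ k * of_bool (dictator n e = 1)"
      unfolding p_def using n e by (intro survival_const noise_dictator) auto
    moreover have dict: "dictator n e = 1" using n e by (simp add: dictator_def) (simp add: e_def)
    ultimately have tx: "?t k 1 e = p ^ k * q ^ k\<^sub>1"
      using dict noise_majority3[OF n, of \<rho>] by (simp add: q_def flip: e_def)
    have "p ^ (k\<^sub>1 + k) = p ^ k * (2 ^ n * p ^ k\<^sub>1) / 2 ^ n" by (simp add: power_add)
    also have "\<dots> < p ^ k * q ^ k\<^sub>1 / 2 ^ n"
      using k\<^sub>1 p by (intro divide_strict_right_mono mult_strict_left_mono) auto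
    also have "\<dots> \<le> mean n (?t k 1)"
      unfolding mean_def tx[symmetric] using nonneg e
      by (intro divide_right_mono member_le_sum) auto
    also have "\<dots> \<le> mean n (?t k 1) + mean n (?t k (-1))"
      using mean_nonneg[of n "?t k (-1)"] nonneg by simp
    finally show ?thesis by simp
  qed
  then show ?thesis unfolding p_def by blast
qed

lemma no_simple_optimal_protocol:
  fixes \<rho> :: real
  assumes \<rho>: "0 < \<rho>" "\<rho> < 1" and n: "3 \<le> n"
  shows "\<exists>k\<^sub>1 k\<^sub>2. nicd_instance (star_with_path k\<^sub>1 k\<^sub>2) \<rho> n (verts (star_with_path k\<^sub>1 k\<^sub>2)) \<and>
    \<not> (\<exists>f. optimal_protocol (star_with_path k\<^sub>1 k\<^sub>2) \<rho> n (verts (star_with_path k\<^sub>1 k\<^sub>2)) f \<and>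
           simple_protocol (verts (star_with_path k\<^sub>1 k\<^sub>2)) f)"
proof -
  let ?value = "\<lambda>k\<^sub>1 k\<^sub>2 u w. \<Sum>s\<in>{1, -1}. mean n (\<lambda>x. survival n \<rho> (\<lambda>x. of_bool (w x = s)) k\<^sub>2 x *
       noise n \<rho> (\<lambda>x. of_bool (u x = s)) x ^ k\<^sub>1)"
  have n1: "1 \<le> n" using n by simp
  obtain k\<^sub>1 where mixed: "\<And>k\<^sub>2. ((1 + \<rho>) / 2) ^ (k\<^sub>1 + k\<^sub>2) < ?value k\<^sub>1 k\<^sub>2 (majority3 n) (dictator n)"
    using exists_star_size_mixed_gt[OF \<rho> n] by blast
  obtain k\<^sub>2 where simple: "\<And>h. balanced n h \<Longrightarrow> ?value k\<^sub>1 k\<^sub>2 h h \<le> ((1 + \<rho>) / 2) ^ (k\<^sub>1 + k\<^sub>2)"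
    using exists_path_length_simple_le[OF \<rho> n1, of k\<^sub>1] by blast
  let ?T = "star_with_path k\<^sub>1 k\<^sub>2"
  let ?V = "verts ?T"
  let ?f = "\<lambda>v\<in>?V. if v \<in> {1..k\<^sub>1} then majority3 n else dictator n"
  have bal: "balanced n (majority3 n)" "balanced n (dictator n)"
    using balanced_majority3[OF n] balanced_dictator[OF n1] by auto
  have agree: "agreement_prob ?T \<rho> n ?V f = ?value k\<^sub>1 k\<^sub>2 u w"
    if bal_u: "balanced n u" and bal_w: "balanced n w" and fv: "\<And>v. v \<in> ?V \<Longrightarrow> f v = (if v \<in> {1..k\<^sub>1} then u else w)" for f u w
  proof (rule agreement_prob_star_with_path)
    show "0 \<le> \<rho>" "\<rho> \<le> 1" using \<rho> by auto
    show "f v = (if v \<in> {1..k\<^sub>1} then u else w)" if v: "v \<in> {0..k\<^sub>1 + k\<^sub>2}" for v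
      using v unfolding verts_star_with_path[symmetric] by (rule fv)
  qed (fact balanced_values[OF bal_u] balanced_values[OF bal_w])+
  have f: "?f \<in> protocols n ?V" using bal by (auto simp: protocols_def)
  have "finite (protocols n ?V)"
    unfolding protocols_def by (intro finite_PiE finite_balanced) (simp add: verts_star_with_path)
  then have "agreement_prob ?T \<rho> n ?V ?f \<le> sup_agreement_prob ?T \<rho> n ?V"
    unfolding sup_agreement_prob_def using f by (intro cSUP_upper bdd_above_finite finite_imageI)
  moreover have "agreement_prob ?T \<rho> n ?V ?f = ?value k\<^sub>1 k\<^sub>2 (majority3 n) (dictator n)"
    using bal by (rule agree) (simp only: restrict_apply if_True)
  ultimately have sup: "((1 + \<rho>) / 2) ^ (k\<^sub>1 + k\<^sub>2) < sup_agreement_prob ?T \<rho> n ?V"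
    using mixed[of k\<^sub>2] by linarith
  have "\<not> (optimal_protocol ?T \<rho> n ?V g \<and> simple_protocol ?V g)" for g
  proof
    assume *: "optimal_protocol ?T \<rho> n ?V g \<and> simple_protocol ?V g"
    then have g: "g \<in> protocols n ?V" "agreement_prob ?T \<rho> n ?V g = sup_agreement_prob ?T \<rho> n ?V"
      by (simp_all only: optimal_protocol_def)
    have eq: "g u = g v" if "u \<in> ?V" "v \<in> ?V" for u v
      using * that unfolding simple_protocol_def by blast
    have root: "0 \<in> ?V" by (simp add: verts_star_with_path)
    have g0: "balanced n (g 0)" using g(1) root by (auto simp: protocols_def)
    have "agreement_prob ?T \<rho> n ?V g = ?value k\<^sub>1 k\<^sub>2 (g 0) (g 0)"
    proof (rule agree[OF g0 g0])
      fix v assume "v \<in> ?V"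
      then show "g v = (if v \<in> {1..k\<^sub>1} then g 0 else g 0)" unfolding if_cancel using root by (rule eq)
    qed
    also have "\<dots> \<le> ((1 + \<rho>) / 2) ^ (k\<^sub>1 + k\<^sub>2)" using g0 by (rule simple)
    finally have "agreement_prob ?T \<rho> n ?V g \<le> ((1 + \<rho>) / 2) ^ (k\<^sub>1 + k\<^sub>2)" .
    with g(2) sup show False by simp
  qed
  moreover have "finite_tree ?T"
    unfolding star_with_path_eq by (rule finite_tree_parent_tree) (rule star_path_parent_less)
  then have "nicd_instance ?T \<rho> n ?V" using \<rho> n1 by (simp add: nicd_instance_def)
  ultimately show ?thesis by blast
qed

theorem theorem6p2:
  shows "(\<exists>(T :: nat ugraph) (\<rho> :: real) (n :: nat) (S :: nat set).
            nicd_instance T \<rho> n S \<and>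
            \<not> (\<exists>f. optimal_protocol T \<rho> n S f \<and> simple_protocol S f))
       \<and> (\<forall>(\<rho> :: real) (n :: nat). 0 < \<rho> \<and> \<rho> < 1 \<and> 4 \<le> n \<longrightarrow>
            (\<exists>(k\<^sub>1 :: nat) (k\<^sub>2 :: nat).
               nicd_instance (star_with_path k\<^sub>1 k\<^sub>2) \<rho> n (verts (star_with_path k\<^sub>1 k\<^sub>2)) \<and>
               \<not> (\<exists>f. optimal_protocol (star_with_path k\<^sub>1 k\<^sub>2) \<rho> n (verts (star_with_path k\<^sub>1 k\<^sub>2)) f \<and>
                      simple_protocol (verts (star_with_path k\<^sub>1 k\<^sub>2)) f)))"
proof (intro conjI allI impI)
  have "0 < (1/2 :: real)" "(1/2 :: real) < 1" "3 \<le> (3 :: nat)" by simp_all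
  then show "\<exists>(T :: nat ugraph) (\<rho> :: real) (n :: nat) (S :: nat set). nicd_instance T \<rho> n S \<and>
      \<not> (\<exists>f. optimal_protocol T \<rho> n S f \<and> simple_protocol S f)"
    using no_simple_optimal_protocol[of "1/2" 3] by blast
next
  fix \<rho> :: real and n :: nat
  assume "0 < \<rho> \<and> \<rho> < 1 \<and> 4 \<le> n"
  then have "0 < \<rho>" "\<rho> < 1" "3 \<le> n" by auto
  then show "\<exists>k\<^sub>1 k\<^sub>2. nicd_instance (star_with_path k\<^sub>1 k\<^sub>2) \<rho> n (verts (star_with_path k\<^sub>1 k\<^sub>2)) \<and>
      \<not> (\<exists>f. optimal_protocol (star_with_path k\<^sub>1 k\<^sub>2) \<rho> n (verts (star_with_path k\<^sub>1 k\<^sub>2)) f \<and>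
             simple_protocol (verts (star_with_path k\<^sub>1 k\<^sub>2)) f)"
    by (rule no_simple_optimal_protocol)
qed

end
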